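(* Let $v_1,\ldots,v_p\in\mathbb{C}^n$ and $V=\operatorname{span}_{\mathbb{R}}\{v_1,\ldots,v_p\}\subset(\mathbb{C}^n)_{\mathbb{R}}$. Then: (i) $\|v_1\wedge\cdots\wedge v_p\|=\rho_V\cdot\mathcal{V}_p(v_1,\ldots,v_p)$. (ii) If $p=n$, then $|\det M(v_1,\ldots,v_n)|=\rho_V\cdot\mathcal{V}_n(v_1,\ldots,v_n)$, where $M(v_1,\ldots,v_n)$ is the $n\times n$ matrix with columns $v_1,\ldots,v_n$.
   Context: $(\mathbb{C}^n)_{\mathbb{R}}=\mathbb{R}^{2n}$ is the underlying real space of $\mathbb{C}^n$, with inner product $\langle\cdot,\cdot\rangle_{\mathbb{R}}=\operatorname{Re}\langle\cdot,\cdot\rangle$, where $\langle\cdot,\cdot\rangle$ is the canonical Hermitian product of $\mathbb{C}^n$. $\wedge$ is the $\mathbb{C}$-bilinear exterior product of the complex Grassmann algebra $\bigwedge\mathbb{C}^n$, with the norm of the induced Hermitian product, so that $\|v_1\wedge\cdots\wedge v_p\|=\sqrt{\det(\langle v_i,v_j\rangle)}$. $\mathcal{V}_p(v_1,\ldots,v_p)$ (also written $\mathcal{V}(v_1,\ldots,v_p)$) is the real $p$-dimensional volume of the parallelotope $\{\sum_{j=1}^p t_jv_j:0\le t_j\le1\}$ in $(\mathbb{C}^n)_{\mathbb{R}}$, defined recursively by $\mathcal{V}(v_1)=\|v_1\|$ and $\mathcal{V}(v_1,\ldots,v_k)=\mathcal{V}(v_1,\ldots,v_{k-1})\cdot\|u_k\|$,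 where $u_k=v_k-\sum_{j=1}^{k-1}c_jv_j$ with $c_j\in\mathbb{R}$ such that $\langle v_j,u_k\rangle_{\mathbb{R}}=0$ for all $j<k$. Holomorphy index: for a real subspace $V\subset(\mathbb{C}^n)_{\mathbb{R}}$ of real dimension $d$, let $\mathrm{i}V=\{\mathrm{i}v:v\in V\}$ and let $0\le\theta_1\le\cdots\le\theta_d\le\frac\pi2$ be the principal angles of $V$ and $\mathrm{i}V$ in $(\mathbb{C}^n)_{\mathbb{R}}$, i.e. the angles for which there are $\langle\cdot,\cdot\rangle_{\mathbb{R}}$-orthonormal bases $(a_1,\ldots,a_d)$ of $V$ and $(b_1,\ldots,b_d)$ of $\mathrm{i}V$ with $\langle a_j,b_k\rangle_{\mathbb{R}}=0$ for $j\neq k$ and $\langle a_j,b_j\rangle_{\mathbb{R}}=\cos\theta_j$. (It is known that $\theta_{2j-1}=\theta_{2j}$ for $1\le j\le\lfloor d/2\rfloor$, and $\theta_d=\frac\pi2$ if $d$ is odd.) The Kähler angles of $V$ are $\mu_j=\theta_{2j-1}$ for $1\le j\le h=\lceil d/2\rceil$, and the holomorphy index of $V$ is $\rho_V=\prod_{j=1}^h\sin\mu_j$ (an empty product is $1$). *)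

theory Defs
  imports "HOL-Analysis.Analysis"
begin

text \<open>
  The space \<open>\<complex>\<^sup>n\<close> is \<^typ>\<open>complex ^ 'n\<close>. Its library inner product \<open>(\<bullet>)\<close> is the real part of
  the canonical Hermitian product, and \<^const>\<open>span\<close> and \<^const>\<open>dim\<close> refer to the underlying real
  space. Finite sequences of vectors \<open>v\<^sub>1, \<dots>, v\<^sub>p\<close> are written \<open>v 0, \<dots>, v (p - 1)\<close> with
  \<open>v :: nat \<Rightarrow> complex ^ 'n\<close>.
\<close>

section \<open>The complex Grassmann algebra\<close>

text \<open>
  A multivector is given by its coordinates with respect to the basis \<open>e\<^sub>I\<close>, where \<open>I\<close> ranges over
  the sets of indices and \<open>e\<^sub>I\<close> is the product of the \<open>e\<^sub>i\<close> with \<open>i \<in> I\<close>, taken in increasing order.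
  The indices are ordered by \<^const>\<open>to_nat\<close>. This basis is orthonormal for the induced Hermitian
  product, so the induced norm is the Euclidean norm of the type.
\<close>

type_synonym 'n multivector = "complex ^ ('n set)"

definition shuffle_sign :: "'n::finite set \<Rightarrow> 'n set \<Rightarrow> complex" where
  "shuffle_sign I J = (- 1) ^ card {(i, j) \<in> I \<times> J. to_nat j < to_nat i}"

text \<open>Bilinear extension of \<open>e\<^sub>I \<and> e\<^sub>J = shuffle_sign I J e\<^sub>I\<^sub>\<union>\<^sub>J\<close> for disjoint \<open>I, J\<close>, and \<open>0\<close> otherwise.\<close>

definition wedge :: "'n::finite multivector \<Rightarrow> 'n multivector \<Rightarrow> 'n multivector" where
  "wedge a b = (\<chi> K. \<Sum>I\<in>Pow K. shuffle_sign I (K - I) * a $ I * b $ (K - I))"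

definition vector_mv :: "complex ^ 'n \<Rightarrow> 'n::finite multivector" where
  "vector_mv x = (\<Sum>i\<in>UNIV. axis {i} (x $ i))"

primrec wedge_prod :: "(nat \<Rightarrow> complex ^ 'n) \<Rightarrow> nat \<Rightarrow> 'n::finite multivector" where
  "wedge_prod v 0 = axis {} 1"
| "wedge_prod v (Suc k) = wedge (wedge_prod v k) (vector_mv (v k))"

lemma wedge_axis:
  "wedge (axis I x) (axis J y) = (if I \<inter> J = {} then axis (I \<union> J) (shuffle_sign I J * x * y) else 0)"
proof -
  have "(\<Sum>A\<in>Pow K. shuffle_sign A (K - A) * axis I x $ A * axis J y $ (K - A)) =
      (if I \<subseteq> K \<and> J = K - I then shuffle_sign I J * x * y else 0)" for K
  proof -
    have "(\<Sum>A\<in>Pow K. shuffle_sign A (K - A) * axis I x $ A * axis J y $ (K - A)) =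
        (\<Sum>A\<in>Pow K. if A = I then (if J = K - I then shuffle_sign I J * x * y else 0) else 0)"
      by (intro sum.cong) (auto simp: axis_def)
    then show ?thesis by (simp add: sum.delta)
  qed
  moreover have "(I \<subseteq> K \<and> J = K - I) \<longleftrightarrow> (I \<inter> J = {} \<and> K = I \<union> J)" for K
    by blast
  ultimately show ?thesis
    by (simp add: vec_eq_iff wedge_def axis_def)
qed

lemma wedge_prod_1: "wedge_prod v 1 = vector_mv (v 0)"
proof -
  have "(\<Sum>A\<in>Pow K. shuffle_sign A (K - A) * axis {} 1 $ A * vector_mv (v 0) $ (K - A)) =
      vector_mv (v 0) $ K" for K
  proof -
    have "(\<Sum>A\<in>Pow K. shuffle_sign A (K - A) * axis {} 1 $ A * vector_mv (v 0) $ (K - A)) =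
        (\<Sum>A\<in>Pow K. if A = {} then vector_mv (v 0) $ K else 0)"
      by (intro sum.cong) (auto simp: axis_def shuffle_sign_def)
    then show ?thesis by (simp add: sum.delta)
  qed
  then show ?thesis by (simp add: vec_eq_iff wedge_def)
qed

section \<open>Volume of a parallelotope\<close>

text \<open>
  The component of \<open>v k\<close> orthogonal to \<open>v 0, \<dots>, v (k - 1)\<close>. It is unique, although the
  coefficients \<open>c\<close> need not be.
\<close>

definition orth_component :: "(nat \<Rightarrow> 'a::real_inner) \<Rightarrow> nat \<Rightarrow> 'a" where
  "orth_component v k =
    (THE u. (\<exists>c :: nat \<Rightarrow> real. u = v k - (\<Sum>j<k. c j *\<^sub>R v j)) \<and> (\<forall>j<k. v j \<bullet> u = 0))"

lemma orth_component_unique: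
  fixes v :: "nat \<Rightarrow> 'a::euclidean_space"
  shows "\<exists>!u. (\<exists>c :: nat \<Rightarrow> real. u = v k - (\<Sum>j<k. c j *\<^sub>R v j)) \<and> (\<forall>j<k. v j \<bullet> u = 0)"
proof -
  obtain y z where y: "y \<in> span (v ` {..<k})" and z: "\<And>w. w \<in> span (v ` {..<k}) \<Longrightarrow> orthogonal z w"
    and yz: "v k = y + z"
    using orthogonal_subspace_decomp_exists[of "v ` {..<k}" "v k"] by metis
  have in_span: "\<exists>c :: nat \<Rightarrow> real. w = (\<Sum>j<k. c j *\<^sub>R v j)" if "w \<in> span (v ` {..<k})" for w
    using that
  proof (induction rule: span_induct_alt)
    case base
    show ?case by (rule exI[of _ "\<lambda>_. 0"]) simp
  next
    case (step c x y)
    then obtain i d where i: "i < k" "x = v i" and d: "y = (\<Sum>j<k. d j *\<^sub>R v j)" by blast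
    have "c *\<^sub>R x = (\<Sum>j<k. (if j = i then c else 0) *\<^sub>R v j)"
      using i by (simp add: if_distrib[of "\<lambda>r. r *\<^sub>R _"] cong: if_cong)
    then have "c *\<^sub>R x + y = (\<Sum>j<k. ((if j = i then c else 0) + d j) *\<^sub>R v j)"
      by (simp add: d scaleR_add_left sum.distrib)
    then show ?case by (intro exI[of _ "\<lambda>j. (if j = i then c else 0) + d j"])
  qed
  show ?thesis
  proof (rule ex1I[of _ z])
    obtain c where "y = (\<Sum>j<k. c j *\<^sub>R v j)" using in_span[OF y] by blast
    then have "z = v k - (\<Sum>j<k. c j *\<^sub>R v j)" using yz by simp
    moreover have "\<forall>j<k. v j \<bullet> z = 0"
      using z by (metis imageI inner_commute lessThan_iff orthogonal_def span_base)
    ultimately show "(\<exists>c :: nat \<Rightarrow> real. z = v k - (\<Sum>j<k. c j *\<^sub>R v j)) \<and> (\<forall>j<k. v j \<bullet> z = 0)"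
      by blast
  next
    fix u
    assume u: "(\<exists>c :: nat \<Rightarrow> real. u = v k - (\<Sum>j<k. c j *\<^sub>R v j)) \<and> (\<forall>j<k. v j \<bullet> u = 0)"
    then obtain c where c: "u = v k - (\<Sum>j<k. c j *\<^sub>R v j)" by blast
    have s: "(\<Sum>j<k. c j *\<^sub>R v j) \<in> span (v ` {..<k})"
      by (intro span_sum span_scale span_base) auto
    have zu: "z - u = (\<Sum>j<k. c j *\<^sub>R v j) - y" using c yz by simp
    have in_s: "z - u \<in> span (v ` {..<k})" unfolding zu by (intro span_diff s y)
    have "orthogonal u (z - u)"
      by (rule orthogonal_to_span[OF in_s]) (use u in \<open>auto simp: orthogonal_def inner_commute\<close>)
    with z[OF in_s] have "(z - u) \<bullet> (z - u) = 0"
      by (simp add: orthogonal_def inner_diff_left)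
    then show "u = z" by simp
  qed
qed

text \<open>
  The recursion starts at \<open>p = 0\<close> with the empty product, which gives \<open>norm (v 0)\<close> for \<open>p = 1\<close>.
\<close>

primrec parallelotope_volume :: "(nat \<Rightarrow> 'a::real_inner) \<Rightarrow> nat \<Rightarrow> real" where
  "parallelotope_volume v 0 = 1"
| "parallelotope_volume v (Suc k) = parallelotope_volume v k * norm (orth_component v k)"

lemma parallelotope_volume_1: "parallelotope_volume v 1 = norm (v 0)"
  by (simp add: orth_component_def)

section \<open>Principal angles, Kaehler angles and holomorphy index\<close>

definition orthonormal_basis :: "'a::euclidean_space list \<Rightarrow> 'a set \<Rightarrow> bool" where
  "orthonormal_basis xs V \<longleftrightarrow> span (set xs) = V \<and>
    (\<forall>j<length xs. \<forall>k<length xs. xs ! j \<bullet> xs ! k = (if j = k then 1 else 0))"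

text \<open>
  Principal angles of two subspaces of the same dimension, as the increasing list
  \<open>\<theta>\<^sub>1 \<le> \<dots> \<le> \<theta>\<^sub>d\<close>, with \<open>\<theta>\<^sub>j\<close> at position \<open>j - 1\<close>.
\<close>

definition principal_angles :: "'a::euclidean_space set \<Rightarrow> 'a set \<Rightarrow> real list" where
  "principal_angles V W = (THE \<theta>. length \<theta> = dim V \<and> sorted \<theta> \<and> set \<theta> \<subseteq> {0..pi/2} \<and>
    (\<exists>a b. orthonormal_basis a V \<and> orthonormal_basis b W \<and>
      (\<forall>j<dim V. \<forall>k<dim V. a ! j \<bullet> b ! k = (if j = k then cos (\<theta> ! j) else 0))))"

definition kaehler_angle :: "(complex ^ 'n) set \<Rightarrow> nat \<Rightarrow> real" where
  "kaehler_angle V j = principal_angles V ((\<lambda>x. \<i> *s x) ` V) ! (2 * j - 1 - 1)"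

definition holomorphy_index :: "(complex ^ 'n) set \<Rightarrow> real" where
  "holomorphy_index V = (\<Prod>j = 1..nat \<lceil>real (dim V) / 2\<rceil>. sin (kaehler_angle V j))"

end

theory Submission
  imports Defs
begin

text \<open>
  Real Gram-Schmidt orthogonalization changes neither the product \<open>v\<^sub>1 \<and> \<dots> \<and> v\<^sub>p\<close> nor its real span
  \<open>V\<close>, and normalizing the resulting vectors takes exactly the volume of the parallelotope out of the
  product (\<open>norm_wedge_prod_eq\<close>). If the vectors are dependent over the reals, both sides vanish. Otherwise
  it remains to see that a real orthonormal basis of \<open>V\<close> has a product of norm \<open>\<rho>\<^sub>V\<close>. Any two such bases
  have the same product up to sign (\<open>wedge_prod_orthonormal_eq\<close>), so one may choose the basis.

  The choice comes from the skew-symmetric form \<open>(x, y) \<mapsto> \<langle>\<i> x, y\<rangle>\<close> on \<open>V\<close>, whose normal form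
  (\<open>skew_form_normal_basis\<close>) pairs the basis vectors so that different pairs are Hermitian orthogonal
  and the two vectors of pair \<open>m\<close> have a Hermitian product of modulus \<open>c\<^sub>m \<in> [0, 1]\<close>. Multiplying the
  basis by \<open>\<i>\<close> and exchanging the vectors of each pair gives principal bases of \<open>V\<close> and \<open>\<i> V\<close>. As
  principal angles are unique by the minimax principle (\<open>principal_cosines_le\<close>), the Kaehler angles
  are \<open>arccos c\<^sub>m\<close>, and \<open>\<rho>\<^sub>V\<close> is the product of the \<open>sqrt (1 - c\<^sub>m\<^sup>2)\<close>. The norm of the product over
  the basis has the same value, because multiplication by pair \<open>m\<close> multiplies the norm by this factor
  (\<open>norm_ext_pair\<close>).

  All norms of products are computed without Gram determinants: multiplication by a vector and its
  adjoint, contraction, satisfy the canonical anticommutation relations (\<open>contract_ext\<close>), which give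
  \<open>\<parallel>a \<and> x\<parallel>\<^sup>2 = \<parallel>x\<parallel>\<^sup>2 \<parallel>a\<parallel>\<^sup>2 - \<parallel>contract x a\<parallel>\<^sup>2\<close> (\<open>norm_ext\<close>), and contraction by a vector that is Hermitian
  orthogonal to all factors of \<open>a\<close> vanishes.

  For \<open>p = n\<close>, Hermitian Gram-Schmidt shows that the modulus of the determinant and the norm of the product
  are equal: both are unchanged by it, and both are the product of the norms on an orthogonal family
  (\<open>norm_det_eq_norm_wedge_prod\<close>).
\<close>

section \<open>Multiplication by a vector and contraction\<close>

abbreviation ext :: "'n::finite multivector \<Rightarrow> complex ^ 'n \<Rightarrow> 'n multivector" where
  "ext a x \<equiv> wedge a (vector_mv x)"

text \<open>
  The canonical Hermitian product, linear in the first argument. Its real part is \<open>(\<bullet>)\<close>.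
\<close>

definition herm :: "complex ^ 'n \<Rightarrow> complex ^ 'n \<Rightarrow> complex" where
  "herm x y = (\<Sum>i\<in>UNIV. x $ i * cnj (y $ i))"

text \<open>
  The sign of moving \<open>e\<^sub>i\<close> from the far right of \<open>e\<^sub>I \<and> e\<^sub>i\<close> to its place in increasing order.
  The comparison is strict, so the sign does not change when \<open>i\<close> is added to or removed from \<open>I\<close>.
\<close>

definition move_sign :: "'n::finite \<Rightarrow> 'n set \<Rightarrow> complex" where
  "move_sign i I = (- 1) ^ card {j \<in> I. to_nat i < to_nat j}"

text \<open>
  The adjoint of multiplication by \<open>x\<close> on the right, see \<open>inner_ext_contract\<close>. In quantum mechanics
  these two operators are the annihilation and the creation of a fermion in the state \<open>x\<close>.
\<close>

definition contract :: "complex ^ 'n \<Rightarrow> 'n::finite multivector \<Rightarrow> 'n multivector" where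
  "contract x b = (\<chi> I. \<Sum>i\<in>- I. move_sign i I * cnj (x $ i) * b $ insert i I)"

lemma move_sign_square: "move_sign i I * move_sign i I = 1"
  by (simp add: move_sign_def flip: power_mult_distrib)

lemma cnj_move_sign: "cnj (move_sign i I) = move_sign i I"
  by (simp add: move_sign_def)

lemma move_sign_insert:
  assumes "k \<notin> I"
  shows "move_sign i (insert k I) = (if to_nat i < to_nat k then - 1 else 1) * move_sign i I"
proof -
  have "{j \<in> insert k I. to_nat i < to_nat j} =
      (if to_nat i < to_nat k then insert k {j \<in> I. to_nat i < to_nat j} else {j \<in> I. to_nat i < to_nat j})"
    by auto
  then show ?thesis using assms by (simp add: move_sign_def)
qed

lemma move_sign_insert_self: "move_sign i (insert i I) = move_sign i I"
  by (cases "i \<in> I") (simp_all add: insert_absorb move_sign_insert)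

lemma move_sign_remove_self: "move_sign i (I - {i}) = move_sign i I"
  by (metis insert_Diff_single move_sign_insert_self)

text \<open>
  Exactly one of \<open>i\<close>, \<open>k\<close> passes the other one. This sign is behind both anticommutation relations
  \<open>ext_swap\<close> and \<open>contract_ext\<close>.
\<close>

lemma move_sign_swap:
  assumes "i \<noteq> k" "i \<notin> I" "k \<notin> I"
  shows "move_sign i (insert k I) * move_sign k I = - (move_sign k (insert i I) * move_sign i I)"
proof -
  have "to_nat i \<noteq> to_nat k" using assms(1) by simp
  then show ?thesis using assms by (auto simp: move_sign_insert not_less_iff_gr_or_eq)
qed

lemma shuffle_sign_singleton: "shuffle_sign I {i} = move_sign i I"
proof -
  have "{(j, k) \<in> I \<times> {i}. to_nat k < to_nat j} = (\<lambda>j. (j, i)) ` {j \<in> I. to_nat i < to_nat j}"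
    by auto
  then show ?thesis
    by (simp add: shuffle_sign_def move_sign_def card_image inj_on_def)
qed

lemma vector_mv_nth: "vector_mv x $ J = (\<Sum>i\<in>UNIV. if J = {i} then x $ i else 0)"
  by (simp add: vector_mv_def axis_def)

lemma ext_nth: "ext a x $ K = (\<Sum>i\<in>K. move_sign i K * x $ i * a $ (K - {i}))"
proof -
  have eq: "(K - I = {i}) = (i \<in> K \<and> I = K - {i})" if "I \<subseteq> K" for I i
    using that by blast
  have "ext a x $ K = (\<Sum>I\<in>Pow K. \<Sum>i\<in>UNIV. if K - I = {i} then move_sign i I * x $ i * a $ I else 0)"
    by (auto simp: wedge_def vector_mv_nth sum_distrib_left shuffle_sign_singleton intro!: sum.cong)
  also have "\<dots> = (\<Sum>i\<in>UNIV. \<Sum>I\<in>Pow K. if K - I = {i} then move_sign i I * x $ i * a $ I else 0)"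
    by (rule sum.swap)
  also have "\<dots> = (\<Sum>i\<in>UNIV. if i \<in> K then move_sign i K * x $ i * a $ (K - {i}) else 0)"
  proof (rule sum.cong[OF refl])
    fix i
    have "(\<Sum>I\<in>Pow K. if K - I = {i} then move_sign i I * x $ i * a $ I else 0) =
        (\<Sum>I\<in>Pow K. if I = K - {i} then (if i \<in> K then move_sign i K * x $ i * a $ (K - {i}) else 0) else 0)"
      by (rule sum.cong[OF refl]) (auto simp: eq move_sign_remove_self)
    then show "(\<Sum>I\<in>Pow K. if K - I = {i} then move_sign i I * x $ i * a $ I else 0) =
        (if i \<in> K then move_sign i K * x $ i * a $ (K - {i}) else 0)"
      by (auto simp: sum.delta)
  qed
  also have "\<dots> = (\<Sum>i\<in>K. move_sign i K * x $ i * a $ (K - {i}))"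
    by (simp add: sum.If_cases)
  finally show ?thesis .
qed

lemma ext_add: "ext a (x + y) = ext a x + ext a y"
  by (simp add: vec_eq_iff ext_nth algebra_simps sum.distrib)

lemma ext_smult: "ext a (c *s x) = c *s ext a x"
  by (simp add: vec_eq_iff ext_nth algebra_simps sum_distrib_left)

lemma ext_smult_left: "ext (c *s a) x = c *s ext a x"
  by (simp add: vec_eq_iff ext_nth algebra_simps sum_distrib_left)

lemma scaleR_eq_smult: "r *\<^sub>R x = of_real r *s (x :: complex ^ 'n)"
  by (simp add: vec_eq_iff scaleR_conv_of_real[where x = "x $ _"])

lemma ext_scaleR: "ext a (r *\<^sub>R x) = r *\<^sub>R ext a x"
  by (simp add: scaleR_eq_smult ext_smult)

lemma ext_scaleR_left: "ext (r *\<^sub>R a) x = r *\<^sub>R ext a x"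
  by (simp add: scaleR_eq_smult ext_smult_left)

lemma ext_zero_left [simp]: "ext 0 x = 0"
  by (simp add: vec_eq_iff ext_nth)

lemma ext_diff: "ext a (x - y) = ext a x - ext a y"
  by (simp add: vec_eq_iff ext_nth algebra_simps sum_subtractf)

lemma ext_diff_left: "ext (a - b) x = ext a x - ext b x"
  by (simp add: vec_eq_iff ext_nth algebra_simps sum_subtractf)

lemma ext_sum: "ext a (\<Sum>j\<in>A. f j) = (\<Sum>j\<in>A. ext a (f j))"
  by (induction A rule: infinite_finite_induct) (simp_all add: ext_add, simp_all add: vec_eq_iff ext_nth)

lemma ext_swap: "ext (ext a x) y = - ext (ext a y) x"
proof -
  \<comment> \<open>The contribution of first taking the factor \<open>x $ i\<close> and then the factor \<open>y $ k\<close>.\<close>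
  define T where "T K x y i k = move_sign k K * y $ k * (move_sign i (K - {k}) * x $ i * a $ (K - {k} - {i}))"
    for K :: "'a set" and x y :: "complex ^ 'a" and i k
  have nth: "ext (ext a x) y $ K = (\<Sum>k\<in>K. \<Sum>i\<in>K - {k}. T K x y i k)" for K x y
    by (simp add: ext_nth T_def sum_distrib_left)
  have swap: "T K x y i k = - T K y x k i" if "i \<in> K" "k \<in> K" "i \<noteq> k" for K i k
  proof -
    define I where "I = K - {i, k}"
    have I: "i \<notin> I" "k \<notin> I" and K: "K - {k} = insert i I" "K - {i} = insert k I"
      using that by (auto simp: I_def)
    have "move_sign k (insert i I) * move_sign i I = - (move_sign i (insert k I) * move_sign k I)"
      using move_sign_swap[of i k I] that(3) I by simp
    moreover have "move_sign k K = move_sign k (insert i I)" "move_sign i K = move_sign i (insert k I)"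
      by (simp_all flip: K add: move_sign_remove_self)
    ultimately have s: "move_sign k K * move_sign i (K - {k}) = - (move_sign i K * move_sign k (K - {i}))"
      by (simp add: K move_sign_insert_self)
    have "T K x y i k = (move_sign k K * move_sign i (K - {k})) * (x $ i * y $ k * a $ (K - {i} - {k}))"
      by (simp add: T_def mult_ac Diff_insert2[symmetric] insert_commute)
    also have "\<dots> = - T K y x k i"
      by (simp add: s T_def mult_ac)
    finally show ?thesis .
  qed
  have "(\<Sum>k\<in>K. \<Sum>i\<in>K - {k}. T K x y i k) = - (\<Sum>i\<in>K. \<Sum>k\<in>K - {i}. T K y x k i)" for K
  proof -
    have sets: "{i \<in> K. k \<noteq> i} = K - {k}" "{i \<in> K. i \<noteq> k} = K - {k}" for k by auto
    have "(\<Sum>k\<in>K. \<Sum>i\<in>{i \<in> K. k \<noteq> i}. T K x y i k) = (\<Sum>i\<in>K. \<Sum>k\<in>{k \<in> K. k \<noteq> i}. T K x y i k)"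
      by (rule sum.swap_restrict) auto
    also have "\<dots> = (\<Sum>i\<in>K. \<Sum>k\<in>K - {i}. - T K y x k i)"
      unfolding sets by (intro sum.cong refl swap) auto
    finally show ?thesis unfolding sets sum_negf .
  qed
  then show ?thesis by (simp add: vec_eq_iff nth)
qed

lemma ext_self: "ext (ext a x) x = 0"
  using ext_swap[of a x x] by (simp add: eq_neg_iff_add_eq_0 flip: scaleR_2)

text \<open>
  The canonical anticommutation relation. In both composites, adding \<open>e\<^sub>k\<close> and removing \<open>e\<^sub>i\<close> for
  \<open>i \<noteq> k\<close> gives the same term with opposite signs. The terms with \<open>i = k\<close> have sign \<open>1\<close>; at the
  coordinate \<open>I\<close> those with \<open>i \<notin> I\<close> come from one composite and those with \<open>i \<in> I\<close> from the other,
  and together they form the Hermitian product.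
\<close>

lemma contract_ext: "contract x (ext a y) = herm y x *s a - ext (contract x a) y"
proof -
  have "contract x (ext a y) $ I + ext (contract x a) y $ I = herm y x * a $ I" for I
  proof -
    define T where "T i k = move_sign k I * y $ k * (move_sign i (I - {k}) * cnj (x $ i) * a $ insert i (I - {k}))" for i k
    have off: "move_sign i I * cnj (x $ i) * (move_sign k (insert i I) * y $ k * a $ (insert i I - {k})) = - T i k"
      if "i \<notin> I" "k \<in> I" for i k
    proof -
      have ne: "i \<noteq> k" using that by auto
      have set_eq: "insert i (I - {k}) = insert i I - {k}" using ne by auto
      have "move_sign k (insert i I) = (if to_nat k < to_nat i then - 1 else 1) * move_sign k I"
        using that by (simp add: move_sign_insert)
      moreover have "move_sign i I = (if to_nat i < to_nat k then - 1 else 1) * move_sign i (I - {k})"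
        using move_sign_insert[of k "I - {k}" i] that by (simp add: insert_absorb)
      moreover have "to_nat i \<noteq> to_nat k" using ne by simp
      ultimately have "move_sign i I * move_sign k (insert i I) = - (move_sign k I * move_sign i (I - {k}))"
        by (auto simp: not_less_iff_gr_or_eq)
      then have "move_sign i I * move_sign k (insert i I) * (cnj (x $ i) * y $ k * a $ (insert i I - {k})) =
          - (move_sign k I * move_sign i (I - {k})) * (cnj (x $ i) * y $ k * a $ (insert i I - {k}))"
        by simp
      then show ?thesis
        by (simp add: T_def set_eq mult_ac)
    qed
    have 1: "contract x (ext a y) $ I = (\<Sum>i\<in>- I. y $ i * cnj (x $ i)) * a $ I - (\<Sum>i\<in>- I. \<Sum>k\<in>I. T i k)"
    proof -
      have "move_sign i I * cnj (x $ i) * ext a y $ insert i I =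
          y $ i * cnj (x $ i) * a $ I - (\<Sum>k\<in>I. T i k)" if "i \<notin> I" for i
      proof -
        have "ext a y $ insert i I = move_sign i I * y $ i * a $ I +
            (\<Sum>k\<in>I. move_sign k (insert i I) * y $ k * a $ (insert i I - {k}))"
          using that by (simp add: ext_nth move_sign_insert_self)
        then have "move_sign i I * cnj (x $ i) * ext a y $ insert i I =
            (move_sign i I * move_sign i I) * (y $ i * cnj (x $ i) * a $ I) + (\<Sum>k\<in>I. - T i k)"
          using off[OF that] by (simp add: algebra_simps sum_distrib_left)
        then show ?thesis by (simp add: move_sign_square sum_negf)
      qed
      then show ?thesis by (simp add: contract_def sum_subtractf sum_distrib_right)
    qed
    have 2: "ext (contract x a) y $ I = (\<Sum>k\<in>I. y $ k * cnj (x $ k)) * a $ I + (\<Sum>k\<in>I. \<Sum>i\<in>- I. T i k)"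
    proof -
      have "move_sign k I * y $ k * contract x a $ (I - {k}) =
          y $ k * cnj (x $ k) * a $ I + (\<Sum>i\<in>- I. T i k)" if "k \<in> I" for k
      proof -
        have "- (I - {k}) = insert k (- I)" "insert k (I - {k}) = I" using that by auto
        then have "contract x a $ (I - {k}) = move_sign k I * cnj (x $ k) * a $ I +
            (\<Sum>i\<in>- I. move_sign i (I - {k}) * cnj (x $ i) * a $ insert i (I - {k}))"
          using that by (simp add: contract_def move_sign_remove_self)
        then have "move_sign k I * y $ k * contract x a $ (I - {k}) =
            (move_sign k I * move_sign k I) * (y $ k * cnj (x $ k) * a $ I) + (\<Sum>i\<in>- I. T i k)"
          by (simp add: T_def algebra_simps sum_distrib_left)
        then show ?thesis by (simp add: move_sign_square)
      qed
      then show ?thesis by (simp add: ext_nth sum.distrib sum_distrib_right)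
    qed
    have "herm y x = (\<Sum>i\<in>I. y $ i * cnj (x $ i)) + (\<Sum>i\<in>- I. y $ i * cnj (x $ i))"
      unfolding herm_def by (subst sum.union_disjoint[symmetric]) (auto simp: Compl_partition)
    then show ?thesis
      unfolding 1 2 by (simp add: algebra_simps sum.swap[of _ I "- I"])
  qed
  then show ?thesis by (simp add: vec_eq_iff eq_diff_eq)
qed

lemma inner_ext_contract: "ext a x \<bullet> b = a \<bullet> contract x b"
proof -
  define T where "T i I = (move_sign i I * x $ i * a $ I) \<bullet> b $ insert i I" for i I
  have "ext a x \<bullet> b = (\<Sum>K\<in>UNIV. \<Sum>i\<in>K. T i (K - {i}))"
    by (auto simp: inner_vec_def ext_nth inner_sum_left T_def move_sign_remove_self insert_absorb intro!: sum.cong)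
  also have "\<dots> = (\<Sum>i\<in>UNIV. \<Sum>K\<in>{K. i \<in> K}. T i (K - {i}))"
    using sum.swap_restrict[of UNIV UNIV "\<lambda>K i. T i (K - {i})" "\<lambda>K i. i \<in> K"] by simp
  also have "\<dots> = (\<Sum>i\<in>UNIV. \<Sum>I\<in>{I. i \<notin> I}. T i I)"
  proof (rule sum.cong[OF refl])
    fix i
    show "(\<Sum>K\<in>{K. i \<in> K}. T i (K - {i})) = (\<Sum>I\<in>{I. i \<notin> I}. T i I)"
      by (rule sum.reindex_bij_witness[of _ "insert i" "\<lambda>K. K - {i}"]) auto
  qed
  also have "\<dots> = (\<Sum>I\<in>UNIV. \<Sum>i\<in>- I. T i I)"
    using sum.swap_restrict[of UNIV UNIV "\<lambda>i I. T i I" "\<lambda>i I. i \<notin> I"] by (simp add: Compl_eq)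
  also have "\<dots> = a \<bullet> contract x b"
  proof -
    have "T i I = a $ I \<bullet> (move_sign i I * cnj (x $ i) * b $ insert i I)" for i I
    proof -
      have "T i I = Re ((move_sign i I * x $ i * a $ I) * cnj (b $ insert i I))"
        by (simp add: T_def inner_complex_def)
      also have "\<dots> = Re (a $ I * cnj (move_sign i I * cnj (x $ i) * b $ insert i I))"
        by (simp only: complex_cnj_mult complex_cnj_cnj cnj_move_sign mult_ac)
      also have "\<dots> = a $ I \<bullet> (move_sign i I * cnj (x $ i) * b $ insert i I)"
        by (simp add: inner_complex_def algebra_simps)
      finally show ?thesis .
    qed
    then show ?thesis by (simp add: inner_vec_def contract_def inner_sum_right)
  qed
  finally show ?thesis .
qed

lemma inner_eq_Re_herm: "x \<bullet> y = Re (herm x y)"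
  by (simp add: inner_vec_def herm_def inner_complex_def)

lemma herm_smult_left: "herm (c *s x) y = c * herm x y"
  by (simp add: herm_def sum_distrib_left mult.assoc)

text \<open>
  Hermitian orthogonality to \<open>x\<close> is real orthogonality to both \<open>x\<close> and \<open>\<i> x\<close>.
\<close>

lemma herm_eq: "herm x y = Complex (x \<bullet> y) (- ((\<i> *s x) \<bullet> y))"
  by (simp add: complex_eq_iff inner_eq_Re_herm herm_smult_left)

lemma herm_self: "herm x x = of_real ((norm x)\<^sup>2)"
proof -
  have "(\<i> *s x) \<bullet> x = 0"
    by (simp add: inner_vec_def inner_complex_def)
  then show ?thesis by (simp add: herm_eq complex_eq_iff power2_norm_eq_inner)
qed

text \<open>
  Adjointness turns the left-hand side into the inner product of \<open>a\<close> and \<open>contract x (ext a x)\<close>, which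
  the anticommutation relation evaluates.
\<close>

lemma norm_ext: "(norm (ext a x))\<^sup>2 = (norm x)\<^sup>2 * (norm a)\<^sup>2 - (norm (contract x a))\<^sup>2"
proof -
  have "(norm (ext a x))\<^sup>2 = a \<bullet> contract x (ext a x)"
    by (simp add: power2_norm_eq_inner inner_ext_contract)
  also have "\<dots> = a \<bullet> ((norm x)\<^sup>2 *\<^sub>R a) - a \<bullet> ext (contract x a) x"
    by (simp only: contract_ext herm_self scaleR_eq_smult inner_diff_right)
  also have "a \<bullet> ext (contract x a) x = contract x a \<bullet> contract x a"
    by (subst inner_commute) (rule inner_ext_contract)
  finally show ?thesis by (simp add: power2_norm_eq_inner)
qed

section \<open>Products of several vectors\<close>

lemma contract_wedge_prod:
  assumes "\<And>j. j < k \<Longrightarrow> herm (v j) x = 0"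
  shows "contract x (wedge_prod v k) = 0"
  using assms
proof (induction k)
  case 0
  show ?case by (simp add: vec_eq_iff contract_def axis_def)
next
  case (Suc k)
  then show ?case by (simp add: contract_ext)
qed

lemma norm_ext_orthogonal:
  assumes "contract x a = 0"
  shows "norm (ext a x) = norm a * norm x"
proof -
  have "(norm (ext a x))\<^sup>2 = (norm a * norm x)\<^sup>2"
    by (simp add: norm_ext assms power_mult_distrib)
  then show ?thesis by simp
qed

lemma norm_wedge_prod_orthogonal:
  assumes "\<And>j k. j < k \<Longrightarrow> k < p \<Longrightarrow> herm (v j) (v k) = 0"
  shows "norm (wedge_prod v p) = (\<Prod>k<p. norm (v k))"
  using assms by (induction p) (simp_all add: norm_ext_orthogonal contract_wedge_prod)

lemma wedge_prod_absorb:
  assumes "j < k"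
  shows "ext (wedge_prod v k) (v j) = 0"
  using assms
proof (induction k)
  case (Suc k)
  show ?case
  proof (cases "j = k")
    case False
    then have "ext (wedge_prod v k) (v j) = 0" using Suc by simp
    then show ?thesis using ext_swap[of "wedge_prod v k" "v k" "v j"] by simp
  qed (simp add: ext_self)
qed simp

text \<open>
  Gram-Schmidt orthogonalization, over the reals or over the complex numbers, does not change the
  product: each correction term is absorbed by a factor that is already present.
\<close>

lemma wedge_prod_unitriangular:
  assumes "\<And>k. k < p \<Longrightarrow> \<exists>c. u k = v k - (\<Sum>j<k. c j *s v j)"
  shows "wedge_prod u p = wedge_prod v p"
  using assms
proof (induction p)
  case (Suc p)
  obtain c where "u p = v p - (\<Sum>j<p. c j *s v j)" using Suc.prems by blast
  then have "ext (wedge_prod v p) (u p) = ext (wedge_prod v p) (v p)"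
    by (simp add: ext_diff ext_sum ext_smult wedge_prod_absorb)
  then show ?case using Suc by simp
qed simp

lemma wedge_prod_scaleR: "wedge_prod (\<lambda>k. r k *\<^sub>R v k) p = (\<Prod>k<p. r k) *\<^sub>R wedge_prod v p"
  by (induction p) (simp_all add: ext_scaleR ext_scaleR_left mult.commute)

lemma wedge_prod_cong:
  assumes "\<And>k. k < p \<Longrightarrow> u k = v k"
  shows "wedge_prod u p = wedge_prod v p"
  using assms by (induction p) simp_all

section \<open>Real orthonormal families\<close>

definition orthonormal_upto :: "(nat \<Rightarrow> 'a::real_inner) \<Rightarrow> nat \<Rightarrow> bool" where
  "orthonormal_upto u p \<longleftrightarrow> (\<forall>j<p. \<forall>k<p. u j \<bullet> u k = (if j = k then 1 else 0))"

lemma orthonormal_uptoD: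
  assumes "orthonormal_upto u p" "j < p" "k < p"
  shows "u j \<bullet> u k = (if j = k then 1 else 0)"
  using assms by (auto simp: orthonormal_upto_def)

lemma inner_orthonormal_sum:
  assumes "orthonormal_upto u p" "k < p" "A \<subseteq> {..<p}"
  shows "u k \<bullet> (\<Sum>j\<in>A. c j *\<^sub>R u j) = (if k \<in> A then c k else 0)"
proof -
  have fin: "finite A" using assms(3) finite_subset by blast
  have "u k \<bullet> (\<Sum>j\<in>A. c j *\<^sub>R u j) = (\<Sum>j\<in>A. if k = j then c j else 0)"
    unfolding inner_sum_right using assms by (intro sum.cong) (auto simp: orthonormal_upto_def subset_iff)
  then show ?thesis using fin by (simp add: sum.delta')
qed

lemma inner_orthonormal_sums:
  assumes "orthonormal_upto u p" "A \<subseteq> {..<p}"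
  shows "(\<Sum>j\<in>A. c j *\<^sub>R u j) \<bullet> (\<Sum>j\<in>A. d j *\<^sub>R u j) = (\<Sum>j\<in>A. c j * d j)"
  unfolding inner_sum_left
  using assms by (intro sum.cong refl) (auto simp: inner_orthonormal_sum subset_iff)

lemma orthonormal_upto_inj_on:
  assumes "orthonormal_upto u p" shows "inj_on u {..<p}"
proof (rule inj_onI)
  fix j k assume jk: "j \<in> {..<p}" "k \<in> {..<p}" "u j = u k"
  then have "u j \<bullet> u k = u j \<bullet> u j" by simp
  then show "j = k" using orthonormal_uptoD[OF assms] jk by (metis lessThan_iff zero_neq_one)
qed

lemma orthonormal_upto_independent:
  fixes u :: "nat \<Rightarrow> 'a::euclidean_space"
  assumes "orthonormal_upto u p" shows "independent (u ` {..<p})"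
proof (rule pairwise_orthogonal_independent)
  show "pairwise orthogonal (u ` {..<p})"
    using assms by (auto simp: pairwise_def orthogonal_def orthonormal_upto_def)
  show "0 \<notin> u ` {..<p}"
    using orthonormal_uptoD[OF assms] by (metis imageE inner_zero_left lessThan_iff zero_neq_one)
qed

lemma dim_span_orthonormal:
  fixes u :: "nat \<Rightarrow> 'a::euclidean_space"
  assumes "orthonormal_upto u p" "A \<subseteq> {..<p}" shows "dim (span (u ` A)) = card A"
proof -
  have "independent (u ` A)"
    using orthonormal_upto_independent[OF assms(1)] assms(2) by (meson image_mono independent_mono)
  then have "dim (span (u ` A)) = card (u ` A)"
    by (simp add: dim_eq_card_independent)
  then show ?thesis
    using orthonormal_upto_inj_on[OF assms(1)] assms(2) by (metis card_image inj_on_subset)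
qed

lemma span_image_sum:
  fixes u :: "'i \<Rightarrow> 'a::real_vector"
  assumes "finite A" "x \<in> span (u ` A)"
  obtains c where "x = (\<Sum>j\<in>A. c j *\<^sub>R u j)"
proof -
  have "\<exists>c. x = (\<Sum>j\<in>A. c j *\<^sub>R u j)"
    using assms(2)
  proof (induction rule: span_induct_alt)
    case base
    show ?case by (rule exI[of _ "\<lambda>_. 0"]) simp
  next
    case (step r x y)
    then obtain i d where i: "i \<in> A" "x = u i" and d: "y = (\<Sum>j\<in>A. d j *\<^sub>R u j)" by blast
    have "(\<Sum>j\<in>A. (d j + (if j = i then r else 0)) *\<^sub>R u j) = y + r *\<^sub>R x"
      using i assms(1) by (simp add: d scaleR_add_left sum.distrib if_distrib[of "\<lambda>r. r *\<^sub>R _"] cong: if_cong)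
    then show ?case by (metis add.commute)
  qed
  then show ?thesis using that by blast
qed

lemma span_orthonormal_expansion:
  assumes "orthonormal_upto u p" "x \<in> span (u ` {..<p})"
  shows "x = (\<Sum>j<p. (u j \<bullet> x) *\<^sub>R u j)"
proof -
  obtain c where c: "x = (\<Sum>j<p. c j *\<^sub>R u j)" using span_image_sum[OF _ assms(2)] by blast
  then have "u j \<bullet> x = c j" if "j < p" for j
    using inner_orthonormal_sum[OF assms(1) that, of "{..<p}" c] that by simp
  then show ?thesis by (subst c) simp
qed

section \<open>Change of a real orthonormal basis\<close>

text \<open>
  The factor is the determinant of the change of the pair; it is \<open>1\<close> for a rotation.
\<close>

lemma ext_rotate:
  "ext (ext a (s *\<^sub>R w - r *\<^sub>R u)) (r *\<^sub>R w + s *\<^sub>R u) = (r * r + s * s) *\<^sub>R ext (ext a w) u"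
proof -
  have "ext (ext a (s *\<^sub>R w - r *\<^sub>R u)) (r *\<^sub>R w + s *\<^sub>R u) =
      s *\<^sub>R s *\<^sub>R ext (ext a w) u - r *\<^sub>R r *\<^sub>R ext (ext a u) w"
    unfolding ext_add ext_scaleR ext_diff_left ext_diff ext_scaleR_left ext_self by simp
  then show ?thesis by (simp add: ext_swap[of a u w] scaleR_add_left)
qed

text \<open>
  By induction, up to sign, the normalized projection \<open>w\<close> of \<open>x\<close> to the span of the first factors can be made the last but one
  factor; \<open>x\<close> then lies in the plane of the last two factors, and it remains to rotate this plane.
\<close>

lemma wedge_prod_orthonormal_last:
  fixes u :: "nat \<Rightarrow> complex ^ 'n"
  assumes "orthonormal_upto u (Suc p)" "x \<in> span (u ` {..<Suc p})" "norm x = 1"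
  shows "\<exists>u' \<epsilon>. orthonormal_upto u' p \<and> (\<forall>j<p. u' j \<in> span (u ` {..<Suc p}) \<and> u' j \<bullet> x = 0) \<and>
    \<bar>\<epsilon>\<bar> = 1 \<and> wedge_prod u (Suc p) = \<epsilon> *\<^sub>R ext (wedge_prod u' p) x"
  using assms
proof (induction p arbitrary: x)
  case 0
  then obtain s where s: "x = s *\<^sub>R u 0"
    by (auto simp: span_singleton lessThan_Suc)
  have "norm (u 0) = 1" using orthonormal_uptoD[OF 0(1), of 0 0] by (simp add: norm_eq_1)
  with s 0(3) have "\<bar>s\<bar> = 1" by simp
  then have "s * s = 1" by (metis abs_mult_self mult.right_neutral)
  then show ?case using s \<open>\<bar>s\<bar> = 1\<close>
    by (intro exI[of _ undefined] exI[of _ s]) (simp add: orthonormal_upto_def ext_scaleR)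
next
  case (Suc p)
  let ?p = "Suc p"
  define y where "y = (\<Sum>j<?p. (u j \<bullet> x) *\<^sub>R u j)"
  define s where "s = u ?p \<bullet> x"
  have on: "orthonormal_upto u ?p" using Suc.prems(1) by (simp add: orthonormal_upto_def)
  have up: "norm (u ?p) = 1" using orthonormal_uptoD[OF Suc.prems(1), of ?p ?p] by (simp add: norm_eq_1)
  have x: "x = y + s *\<^sub>R u ?p"
    using span_orthonormal_expansion[OF Suc.prems(1,2)] by (simp add: y_def s_def)
  have y_span: "y \<in> span (u ` {..<?p})"
    unfolding y_def by (intro span_sum span_scale span_base) auto
  have orth: "z \<bullet> u ?p = 0" if "z \<in> span (u ` {..<?p})" for z
  proof -
    have "orthogonal (u ?p) z"
      by (rule orthogonal_to_span[OF that]) (use Suc.prems(1) in \<open>auto simp: orthogonal_def orthonormal_upto_def\<close>)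
    then show ?thesis by (simp add: orthogonal_def inner_commute)
  qed
  have mono: "span (u ` {..<?p}) \<subseteq> span (u ` {..<Suc ?p})"
    by (intro span_mono image_mono) auto
  have upin: "u ?p \<in> span (u ` {..<Suc ?p})" by (intro span_base) auto
  have "(norm x)\<^sup>2 = (norm y)\<^sup>2 + s\<^sup>2"
    using orth[OF y_span] up unfolding power2_norm_eq_inner norm_eq_1
    by (subst (1 2) x) (simp add: inner_add_left inner_add_right inner_commute[of "u ?p" y] power2_eq_square)
  then have norm1: "(norm y)\<^sup>2 + s\<^sup>2 = 1" using Suc.prems(3) by simp
  show ?case
  proof (cases "y = 0")
    case True
    then have "s\<^sup>2 = 1" using norm1 by simp
    then have "\<bar>s\<bar> = 1" by (simp add: abs_square_eq_1)
    have "s * s = 1" using \<open>s\<^sup>2 = 1\<close> by (simp only: power2_eq_square)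
    then have "wedge_prod u (Suc ?p) = s *\<^sub>R ext (wedge_prod u ?p) x"
      by (simp add: x True ext_scaleR)
    moreover have "u j \<bullet> x = 0" if "j < ?p" for j
      using orth[of "u j"] that by (simp add: x True span_base)
    moreover have "u j \<in> span (u ` {..<Suc ?p})" if "j < ?p" for j
      using that by (intro span_base) auto
    ultimately show ?thesis using on \<open>\<bar>s\<bar> = 1\<close> by blast
  next
    case False
    define r where "r = norm y"
    define w where "w = (1 / r) *\<^sub>R y"
    have r: "r \<noteq> 0" "r * r + s * s = 1" using False norm1 by (simp_all add: r_def power2_eq_square)
    have y: "y = r *\<^sub>R w" using r by (simp add: w_def)
    have w_span: "w \<in> span (u ` {..<?p})" using y_span by (simp add: w_def span_scale)
    have w1: "norm w = 1" using False by (simp add: w_def r_def)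
    obtain u' \<epsilon> where u': "orthonormal_upto u' p"
        "\<And>j. j < p \<Longrightarrow> u' j \<in> span (u ` {..<?p})" "\<And>j. j < p \<Longrightarrow> u' j \<bullet> w = 0" "\<bar>\<epsilon>\<bar> = 1"
        "wedge_prod u ?p = \<epsilon> *\<^sub>R ext (wedge_prod u' p) w"
      using Suc.IH[OF on w_span w1] by metis
    \<comment> \<open>The plane of \<open>w\<close> and \<open>u ?p\<close> contains \<open>x\<close>; complete \<open>x\<close> to an orthonormal basis of this plane.\<close>
    define z where "z = s *\<^sub>R w - r *\<^sub>R u ?p"
    define u'' where "u'' j = (if j < p then u' j else z)" for j
    have wu: "w \<bullet> u ?p = 0" "u ?p \<bullet> w = 0" using orth[OF w_span] by (simp_all add: inner_commute)
    have ww: "w \<bullet> w = 1" "u ?p \<bullet> u ?p = 1" using w1 up by (simp_all add: norm_eq_1)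
    have zz: "z \<bullet> z = 1" using r(2) by (simp add: z_def inner_diff_left inner_diff_right wu ww)
    have zx: "z \<bullet> x = 0"
      by (simp add: z_def x y inner_diff_left inner_add_right wu ww)
    have u'z: "u' j \<bullet> z = 0" "u' j \<bullet> x = 0" "z \<bullet> u' j = 0" if "j < p" for j
      using u'(3)[OF that] orth[OF u'(2)[OF that]] by (simp_all add: z_def x y inner_diff_right inner_add_right inner_commute[of _ "u' j"])
    have on'': "orthonormal_upto u'' ?p"
      using u'(1) u'z(1,3) zz by (auto simp: orthonormal_upto_def u''_def less_Suc_eq)
    have sp'': "u'' j \<in> span (u ` {..<Suc ?p}) \<and> u'' j \<bullet> x = 0" if "j < ?p" for j
    proof -
      have "z \<in> span (u ` {..<Suc ?p})"
        unfolding z_def using mono w_span upin by (intro span_diff span_scale) auto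
      then show ?thesis using u'(2) u'z(2) zx mono by (auto simp: u''_def)
    qed
    define a where "a = wedge_prod u' p"
    have "wedge_prod u'' p = a" unfolding a_def by (rule wedge_prod_cong) (simp add: u''_def)
    then have "ext (wedge_prod u'' ?p) x = ext (ext a (s *\<^sub>R w - r *\<^sub>R u ?p)) (r *\<^sub>R w + s *\<^sub>R u ?p)"
      by (simp add: u''_def z_def x y)
    also have "\<dots> = (r * r + s * s) *\<^sub>R ext (ext a w) (u ?p)"
      by (rule ext_rotate)
    finally have "ext (wedge_prod u'' ?p) x = ext (ext a w) (u ?p)" using r(2) by simp
    moreover have "wedge_prod u (Suc ?p) = \<epsilon> *\<^sub>R ext (ext a w) (u ?p)"
      using u'(5) by (simp add: a_def ext_scaleR_left)
    ultimately show ?thesis using on'' sp'' u'(4) by metis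
  qed
qed

text \<open>
  Move the last vector of \<open>e\<close> to the end of the product over \<open>u\<close>, and apply induction to the remaining vectors, which lie in
  the orthogonal complement of \<open>e p\<close>. This replaces the usual argument by the determinant of the change
  of basis.
\<close>

lemma wedge_prod_orthonormal_eq:
  fixes u e :: "nat \<Rightarrow> complex ^ 'n"
  assumes "orthonormal_upto u p" "orthonormal_upto e p" "u ` {..<p} \<subseteq> span (e ` {..<p})"
  shows "\<exists>\<epsilon>. \<bar>\<epsilon>\<bar> = 1 \<and> wedge_prod u p = \<epsilon> *\<^sub>R wedge_prod e p"
  using assms
proof (induction p arbitrary: u)
  case 0
  show ?case by (intro exI[of _ 1]) simp
next
  case (Suc p)
  have "span (u ` {..<Suc p}) = span (e ` {..<Suc p})"
    using Suc.prems by (intro subspace_dim_equal) (simp_all add: dim_span_orthonormal span_minimal del: dim_span)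
  then have ep: "e p \<in> span (u ` {..<Suc p})" by (simp add: span_base)
  have "norm (e p) = 1" using Suc.prems(2) by (simp add: orthonormal_upto_def norm_eq_1)
  from wedge_prod_orthonormal_last[OF Suc.prems(1) ep this]
  obtain u' \<epsilon> where u': "orthonormal_upto u' p" "\<And>j. j < p \<Longrightarrow> u' j \<in> span (u ` {..<Suc p})"
      "\<And>j. j < p \<Longrightarrow> u' j \<bullet> e p = 0" "\<bar>\<epsilon>\<bar> = 1" "wedge_prod u (Suc p) = \<epsilon> *\<^sub>R ext (wedge_prod u' p) (e p)"
    by metis
  have one: "orthonormal_upto e p" using Suc.prems(2) by (simp add: orthonormal_upto_def)
  have "u' j \<in> span (e ` {..<p})" if "j < p" for j
  proof -
    have "u' j = (\<Sum>i<Suc p. (e i \<bullet> u' j) *\<^sub>R e i)"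
      using span_orthonormal_expansion[OF Suc.prems(2)] u'(2)[OF that] \<open>span (u ` {..<Suc p}) = _\<close> by simp
    then have "u' j = (\<Sum>i<p. (e i \<bullet> u' j) *\<^sub>R e i)"
      using u'(3)[OF that] by (simp add: inner_commute)
    moreover have "(\<Sum>i<p. (e i \<bullet> u' j) *\<^sub>R e i) \<in> span (e ` {..<p})"
      by (intro span_sum span_scale span_base) auto
    ultimately show ?thesis by simp
  qed
  then obtain \<delta> where \<delta>: "\<bar>\<delta>\<bar> = 1" "wedge_prod u' p = \<delta> *\<^sub>R wedge_prod e p"
    using Suc.IH[OF u'(1) one] by blast
  have "wedge_prod u (Suc p) = (\<epsilon> * \<delta>) *\<^sub>R wedge_prod e (Suc p)"
    unfolding u'(5) \<delta>(2) by (simp add: ext_scaleR_left)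
  moreover have "\<bar>\<epsilon> * \<delta>\<bar> = 1" using u'(4) \<delta>(1) by (simp add: abs_mult)
  ultimately show ?case by blast
qed

section \<open>Determinants\<close>

lemma herm_add_left: "herm (x + y) z = herm x z + herm y z"
  by (simp add: herm_def algebra_simps sum.distrib)

lemma herm_diff_left: "herm (x - y) z = herm x z - herm y z"
  by (simp add: herm_def algebra_simps sum_subtractf)

lemma herm_sum_left: "herm (\<Sum>j\<in>A. f j) z = (\<Sum>j\<in>A. herm (f j) z)"
  by (induction A rule: infinite_finite_induct) (simp_all add: herm_add_left, simp_all add: herm_def)

text \<open>
  Complex projection is real projection to the span of the vectors and their multiples by \<open>\<i>\<close>.
\<close>

lemma hermitian_orthogonal_component:
  fixes v :: "nat \<Rightarrow> complex ^ 'n"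
  shows "\<exists>u c. u = v k - (\<Sum>j<k. c j *s v j) \<and> (\<forall>j<k. herm (v j) u = 0)"
proof -
  define S where "S = v ` {..<k} \<union> (\<lambda>j. \<i> *s v j) ` {..<k}"
  obtain y z where y: "y \<in> span S" and z: "\<And>w. w \<in> span S \<Longrightarrow> orthogonal z w" and yz: "v k = y + z"
    using orthogonal_subspace_decomp_exists[of S "v k"] by metis
  have "\<exists>c. y = (\<Sum>j<k. c j *s v j)"
    using y
  proof (induction rule: span_induct_alt)
    case base
    show ?case by (rule exI[of _ "\<lambda>_. 0"]) simp
  next
    case (step r x w)
    then obtain i s d where i: "i < k" "x = s *s v i" and d: "w = (\<Sum>j<k. d j *s v j)"
      by (auto simp: S_def) (metis vector_smult_lid)
    have "(\<Sum>j<k. (d j + (if j = i then of_real r * s else 0)) *s v j) = w + r *\<^sub>R x"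
      using i by (simp add: d scaleR_eq_smult vector_sadd_rdistrib sum.distrib vector_smult_assoc
          if_distrib[of "\<lambda>r. r *s _"] cong: if_cong)
    then show ?case by (metis add.commute)
  qed
  then obtain c :: "nat \<Rightarrow> complex" where "y = (\<Sum>j<k. c j *s v j)" by blast
  then have "z = v k - (\<Sum>j<k. c j *s v j)" using yz by simp
  moreover have "herm (v j) z = 0" if "j < k" for j
  proof -
    have "v j \<in> span S" "\<i> *s v j \<in> span S" using that by (auto simp: S_def intro: span_base)
    then have "v j \<bullet> z = 0" "(\<i> *s v j) \<bullet> z = 0" using z by (metis inner_commute orthogonal_def)+
    then show ?thesis by (simp add: herm_eq complex_eq_iff)
  qed
  ultimately show ?thesis by (intro exI[of _ z] exI[of _ c]) simp
qed

lemma hermitian_gram_schmidt: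
  fixes v :: "nat \<Rightarrow> complex ^ 'n"
  obtains u where "\<And>k. \<exists>c. u k = v k - (\<Sum>j<k. c j *s v j)" "\<And>j k. j < k \<Longrightarrow> herm (u j) (u k) = 0"
proof -
  obtain u where u: "\<And>k. \<exists>c. u k = v k - (\<Sum>j<k. c j *s v j)" and v: "\<And>k j. j < k \<Longrightarrow> herm (v j) (u k) = 0"
    using hermitian_orthogonal_component[of v] by metis
  have "herm (u j) (u k) = 0" if "j < k" for j k
  proof -
    obtain c where "u j = v j - (\<Sum>i<j. c i *s v i)" using u by blast
    then show ?thesis using v that by (simp add: herm_diff_left herm_sum_left herm_smult_left)
  qed
  then show ?thesis using that u by blast
qed

lemma det_rows_unitriangular:
  fixes u v :: "nat \<Rightarrow> complex ^ 'n" and pos :: "'n \<Rightarrow> nat"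
  assumes pos: "bij_betw pos UNIV {..<p}" and u: "\<And>k. k < p \<Longrightarrow> \<exists>c. u k = v k - (\<Sum>j<k. c j *s v j)"
  shows "det (\<chi> i. u (pos i)) = det (\<chi> i. v (pos i))"
proof -
  \<comment> \<open>Replace the rows one at a time, the last ones first.\<close>
  define A where "A m = (\<chi> i. if pos i < m then v (pos i) else u (pos i))" for m
  have step: "det (A m) = det (A (Suc m))" if m: "m < p" for m
  proof -
    obtain r where r: "pos r = m" using pos m by (metis bij_betw_imp_surj_on imageE lessThan_iff)
    have inj: "pos i = m \<longleftrightarrow> i = r" for i using pos r by (metis bij_betw_imp_inj_on injD)
    obtain c where c: "u m = v m - (\<Sum>j<m. c j *s v j)" using u m by blast
    define x where "x = - (\<Sum>j<m. c j *s v j)"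
    have "x \<in> vec.span {row j (A (Suc m)) | j. j \<noteq> r}"
      unfolding x_def
    proof (intro vec.span_neg vec.span_sum vec.span_scale vec.span_base)
      fix j assume "j \<in> {..<m}"
      then obtain i where i: "pos i = j" using pos m
        by (metis bij_betw_imp_surj_on imageE lessThan_iff less_trans)
      then have "i \<noteq> r" "row i (A (Suc m)) = v j"
        using \<open>j \<in> {..<m}\<close> r by (auto simp: row_def A_def vec_eq_iff)
      then show "v j \<in> {row j (A (Suc m)) | j. j \<noteq> r}"
        by (intro CollectI exI[of _ i]) simp
    qed
    then have "det (\<chi> k. if k = r then row r (A (Suc m)) + x else row k (A (Suc m))) = det (A (Suc m))"
      by (rule det_row_span)
    moreover have "(\<chi> k. if k = r then row r (A (Suc m)) + x else row k (A (Suc m))) = A m"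
    proof -
      have "(if k = r then row r (A (Suc m)) + x else row k (A (Suc m))) = A m $ k" for k
        using inj[of k] by (cases "k = r") (simp_all add: row_def A_def x_def c r less_Suc_eq)
      then show ?thesis by (simp add: vec_eq_iff)
    qed
    ultimately show ?thesis by simp
  qed
  have "m \<le> p \<Longrightarrow> det (A 0) = det (A m)" for m
    by (induction m) (use step in auto)
  from this[of p] have "det (A 0) = det (A p)" by simp
  moreover have "pos i < p" for i using pos by (metis bij_betwE iso_tuple_UNIV_I lessThan_iff)
  ultimately show ?thesis by (simp add: A_def)
qed

lemma cnj_det: "cnj (det A) = det (\<chi> i j. cnj (A $ i $ j))"
  unfolding det_def cnj_sum complex_cnj_mult cnj_prod complex_cnj_of_int by simp

lemma norm_det_orthogonal_rows:
  fixes u :: "'n \<Rightarrow> complex ^ 'n"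
  assumes "\<And>i j. i \<noteq> j \<Longrightarrow> herm (u i) (u j) = 0"
  shows "cmod (det (\<chi> i. u i)) = (\<Prod>i\<in>UNIV. norm (u i))"
proof -
  define A where "A = (\<chi> i. u i)"
  define B where "B = (\<chi> i j. cnj (A $ i $ j))"
  have "of_real ((cmod (det A))\<^sup>2) = det A * cnj (det A)"
    by (rule complex_norm_square)
  also have "\<dots> = det (A ** transpose B)"
    by (simp add: cnj_det det_mul B_def)
  also have "A ** transpose B = (\<chi> i j. herm (u i) (u j))"
    by (simp add: vec_eq_iff matrix_matrix_mult_def transpose_def A_def B_def herm_def)
  also have "det \<dots> = (\<Prod>i\<in>UNIV. herm (u i) (u i))"
    using assms by (subst det_diagonal) auto
  also have "\<dots> = of_real ((\<Prod>i\<in>UNIV. norm (u i))\<^sup>2)"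
    by (simp add: herm_self prod_power_distrib)
  finally have "(cmod (det A))\<^sup>2 = (\<Prod>i\<in>UNIV. norm (u i))\<^sup>2"
    by (simp only: of_real_eq_iff)
  then show ?thesis by (simp add: A_def prod_nonneg)
qed

text \<open>
  Hermitian Gram-Schmidt changes neither the determinant nor the product, and on an orthogonal family
  both have the product of the norms as their norm. This avoids any comparison of the coordinate of the
  multivector with the signed expansion of the determinant.
\<close>

lemma norm_det_eq_norm_wedge_prod:
  fixes v :: "nat \<Rightarrow> complex ^ 'n" and pos :: "'n \<Rightarrow> nat"
  assumes pos: "bij_betw pos UNIV {..<p}"
  shows "cmod (det (\<chi> i j. v (pos j) $ i)) = norm (wedge_prod v p)"
proof -
  obtain u where u: "\<And>k. \<exists>c. u k = v k - (\<Sum>j<k. c j *s v j)"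
      and orth: "\<And>j k. j < k \<Longrightarrow> herm (u j) (u k) = 0"
    using hermitian_gram_schmidt[of v] by blast
  have orth': "herm (u j) (u k) = 0" if "j \<noteq> k" for j k
  proof (cases "j < k")
    case False
    then have "herm (u k) (u j) = 0" using orth that by simp
    moreover have "herm (u j) (u k) = cnj (herm (u k) (u j))" by (simp add: herm_def mult.commute)
    ultimately show ?thesis by simp
  qed (rule orth)
  have inj: "inj pos" using pos by (rule bij_betw_imp_inj_on)
  have "det (\<chi> i j. v (pos j) $ i) = det (\<chi> i. v (pos i))"
    using det_transpose[of "\<chi> i. v (pos i)"] by (simp add: transpose_def)
  also have "\<dots> = det (\<chi> i. u (pos i))"
    using det_rows_unitriangular[OF pos u] by simp
  also have "cmod \<dots> = (\<Prod>i\<in>UNIV. norm (u (pos i)))"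
    using inj by (intro norm_det_orthogonal_rows orth') (simp add: inj_eq)
  also have "\<dots> = (\<Prod>k<p. norm (u k))"
    by (rule prod.reindex_bij_betw[OF pos])
  also have "\<dots> = norm (wedge_prod u p)"
    by (rule norm_wedge_prod_orthogonal[symmetric]) (rule orth)
  also have "wedge_prod u p = wedge_prod v p"
    by (rule wedge_prod_unitriangular) (rule u)
  finally show ?thesis .
qed

section \<open>Normal form of a skew-symmetric form\<close>

lemma orthonormal_upto_exists:
  fixes V :: "'a::euclidean_space set"
  assumes "subspace V"
  obtains b where "orthonormal_upto b (dim V)" "span (b ` {..<dim V}) = V"
proof -
  obtain B where B: "pairwise orthogonal B" "\<And>x. x \<in> B \<Longrightarrow> norm x = 1" "independent B" "card B = dim V" "span B = V"
    using orthonormal_basis_subspace[OF assms] by metis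
  have "finite B" using B(3) by (rule independent_imp_finite)
  then obtain b where b: "bij_betw b {0..<card B} B" using ex_bij_betw_nat_finite by blast
  have "b j \<bullet> b k = (if j = k then 1 else 0)" if "j < dim V" "k < dim V" for j k
  proof -
    have mem: "b j \<in> B" "b k \<in> B" using b that B(4) by (auto simp: bij_betw_def)
    moreover have "b j \<noteq> b k" if "j \<noteq> k"
      using b that \<open>j < dim V\<close> \<open>k < dim V\<close> B(4) by (auto simp: bij_betw_def inj_on_def)
    ultimately show ?thesis using B(1,2) by (auto simp: pairwise_def orthogonal_def norm_eq_1)
  qed
  moreover have "span (b ` {..<dim V}) = V"
    using b B(4,5) by (simp add: bij_betw_def atLeast0LessThan)
  ultimately show ?thesis using that[of b] by (simp add: orthonormal_upto_def)
qed

text \<open>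
  On \<open>V\<close> the functional is the inner product with some \<open>w \<in> V\<close>, and by the equality case of the
  Cauchy-Schwarz inequality, unless \<open>w = 0\<close>, it is maximal on the unit sphere only at the
  normalized \<open>w\<close>.
\<close>

lemma functional_zero_orthogonal_to_maximizer:
  fixes f :: "'a::euclidean_space \<Rightarrow> real"
  assumes V: "subspace V" and f: "linear f" and v: "v \<in> V" "norm v = 1"
    and max: "\<And>x. x \<in> V \<Longrightarrow> norm x = 1 \<Longrightarrow> f x \<le> f v" and y: "y \<in> V" "v \<bullet> y = 0"
  shows "f y = 0"
proof -
  define g where "g = adjoint f 1"
  have fg: "f x = g \<bullet> x" for x
    using adjoint_works[OF f, of x 1] by (simp add: g_def inner_commute)
  obtain w z where w: "w \<in> span V" and z: "\<And>x. x \<in> span V \<Longrightarrow> orthogonal z x" and g: "g = w + z"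
    using orthogonal_subspace_decomp_exists[of V g] by metis
  have wV: "w \<in> V" using w V by (simp add: span_eq_iff[THEN iffD2])
  have fw: "f x = w \<bullet> x" if "x \<in> V" for x
    using z[of x] that by (simp add: fg g inner_add_left orthogonal_def span_base)
  have "f (- v) \<le> f v" using max[of "- v"] v V by (simp add: subspace_neg)
  then have pos: "0 \<le> f v" by (simp add: linear_neg[OF f])
  have le: "norm w \<le> f v"
  proof (cases "w = 0")
    case False
    have "f ((1 / norm w) *\<^sub>R w) \<le> f v"
      using False wV V by (intro max) (simp_all add: subspace_scale)
    moreover have "f ((1 / norm w) *\<^sub>R w) = norm w"
      using False wV V by (simp add: fw subspace_scale flip: power2_norm_eq_inner) (simp add: power2_eq_square)
    ultimately show ?thesis by simp
  qed (use pos in simp)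
  have "(norm (w - f v *\<^sub>R v))\<^sup>2 = (norm w)\<^sup>2 - (f v)\<^sup>2"
    using fw[OF v(1)] v(2)
    by (simp add: power2_norm_eq_inner norm_eq_1 inner_diff_left inner_diff_right inner_commute[of v w]) (simp add: power2_eq_square)
  also have "\<dots> \<le> 0" using le by (simp add: power_mono)
  finally have "w = f v *\<^sub>R v" by simp
  then have "f y = f v * (v \<bullet> y)" using fw[OF y(1)] by simp
  then show ?thesis using y(2) by simp
qed

text \<open>
  A maximizing pair exists by compactness. If the maximum is not \<open>0\<close>, it is automatically orthogonal,
  because \<open>B e\<close> vanishes at \<open>e\<close> and on the complement of \<open>f\<close>.
\<close>

lemma skew_form_maximizer:
  fixes B :: "'a::euclidean_space \<Rightarrow> 'a \<Rightarrow> real"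
  assumes B: "bilinear B" and skew: "\<And>x y. B x y = - B y x" and V: "subspace V" and dim: "2 \<le> dim V"
  obtains e f where "e \<in> V" "f \<in> V" "norm e = 1" "norm f = 1" "e \<bullet> f = 0"
    "\<And>x y. x \<in> V \<Longrightarrow> y \<in> V \<Longrightarrow> norm x = 1 \<Longrightarrow> norm y = 1 \<Longrightarrow> B x y \<le> B e f"
proof -
  obtain b where b: "orthonormal_upto b (dim V)" "span (b ` {..<dim V}) = V"
    using orthonormal_upto_exists[OF V] .
  have "b 0 \<in> span (b ` {..<dim V})" "b 1 \<in> span (b ` {..<dim V})"
    using dim by (auto intro: span_base)
  then have b01: "b 0 \<in> V" "b 1 \<in> V" "norm (b 0) = 1" "norm (b 1) = 1" "b 0 \<bullet> b 1 = 0"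
    using dim b by (simp_all add: orthonormal_upto_def norm_eq_1)
  define S where "S = V \<inter> sphere 0 1"
  have "compact S" unfolding S_def using V by (intro closed_Int_compact closed_subspace) auto
  moreover have "S \<noteq> {}" using b01 by (auto simp: S_def)
  moreover have "continuous_on (S \<times> S) (\<lambda>z. B (fst z) (snd z))"
    using bounded_bilinear.continuous_on[OF B[unfolded bilinear_conv_bounded_bilinear], OF continuous_on_fst[OF continuous_on_id] continuous_on_snd[OF continuous_on_id]] .
  ultimately obtain z where z: "z \<in> S \<times> S" "\<And>z'. z' \<in> S \<times> S \<Longrightarrow> B (fst z') (snd z') \<le> B (fst z) (snd z)"
    using continuous_attains_sup[of "S \<times> S" "\<lambda>z. B (fst z) (snd z)"] compact_Times[of S S] by blast
  obtain e f where ef: "z = (e, f)" by fastforce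
  have mem: "e \<in> V" "f \<in> V" "norm e = 1" "norm f = 1" using z(1) by (simp_all add: ef S_def)
  have max: "B x y \<le> B e f" if "x \<in> V" "y \<in> V" "norm x = 1" "norm y = 1" for x y
    using z(2)[of "(x, y)"] that by (simp add: ef S_def)
  have lin: "linear (B e)" using B by (simp add: bilinear_def)
  show ?thesis
  proof (cases "B e f = 0")
    case False
    have "B e (e - (f \<bullet> e) *\<^sub>R f) = 0"
    proof (rule functional_zero_orthogonal_to_maximizer[OF V lin mem(2,4)])
      show "f \<bullet> (e - (f \<bullet> e) *\<^sub>R f) = 0" using mem(4) by (simp add: inner_diff_right norm_eq_1)
    qed (use max mem V in \<open>auto intro: subspace_diff subspace_scale\<close>)
    moreover have "B e e = 0" using skew[of e e] by simp
    ultimately have "(f \<bullet> e) * B e f = 0" by (simp add: linear_diff[OF lin] linear_scale[OF lin])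
    then have "e \<bullet> f = 0" using False by (simp add: inner_commute)
    then show ?thesis using that mem max by blast
  next
    case True
    \<comment> \<open>The form vanishes on \<open>V\<close>, and any orthonormal pair is a maximizer.\<close>
    have "B (b 0) (b 1) \<ge> 0" using max[of "b 1" "b 0"] b01 skew[of "b 0" "b 1"] True by simp
    then show ?thesis using that[OF b01] max True by force
  qed
qed

text \<open>
  The block diagonal matrix with blocks \<open>[0, c m; - c m, 0]\<close>.
\<close>

definition skew_entry :: "(nat \<Rightarrow> real) \<Rightarrow> nat \<Rightarrow> nat \<Rightarrow> real" where
  "skew_entry c j k = (if even j \<and> k = Suc j then c (j div 2)
    else if even k \<and> j = Suc k then - c (k div 2) else 0)"

text \<open>
  Split off the plane of a maximizing pair \<open>e\<close>, \<open>f\<close>: by maximality \<open>B e\<close> and \<open>B f\<close> vanish on its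
  orthogonal complement \<open>W\<close> in \<open>V\<close>, to which induction applies. Maximality also makes the sequence \<open>c\<close>
  decreasing. If the dimension is odd, the last vector has no partner and its block is \<open>0\<close>; the zeros of
  \<open>c\<close> beyond the dimension record this.
\<close>

lemma skew_form_normal_basis:
  fixes B :: "'a::euclidean_space \<Rightarrow> 'a \<Rightarrow> real"
  assumes B: "bilinear B" and skew: "\<And>x y. B x y = - B y x" and "subspace V"
  shows "\<exists>b c. orthonormal_upto b (dim V) \<and> span (b ` {..<dim V}) = V \<and>
    (\<forall>j<dim V. \<forall>k<dim V. B (b j) (b k) = skew_entry c j k) \<and>
    decseq c \<and> (\<forall>m. 0 \<le> c m) \<and> (\<forall>m. dim V \<le> Suc (2 * m) \<longrightarrow> c m = 0)"
  using assms(3)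
proof (induction "dim V" arbitrary: V rule: less_induct)
  case less
  note V = less.prems
  have self: "B x x = 0" for x using skew[of x x] by simp
  show ?case
  proof (cases "2 \<le> dim V")
    case False
    obtain b where b: "orthonormal_upto b (dim V)" "span (b ` {..<dim V}) = V"
      using orthonormal_upto_exists[OF V] .
    have "B (b j) (b k) = skew_entry (\<lambda>_. 0) j k" if "j < dim V" "k < dim V" for j k
    proof -
      have "j = k" using that False by linarith
      then show ?thesis by (simp add: self skew_entry_def)
    qed
    then show ?thesis using b by (intro exI[of _ b] exI[of _ "\<lambda>_. 0"]) (simp add: decseq_def)
  next
    case True
    obtain e f where ef: "e \<in> V" "f \<in> V" "norm e = 1" "norm f = 1" "e \<bullet> f = 0"
      and max: "\<And>x y. x \<in> V \<Longrightarrow> y \<in> V \<Longrightarrow> norm x = 1 \<Longrightarrow> norm y = 1 \<Longrightarrow> B x y \<le> B e f"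
      using skew_form_maximizer[OF B skew V True] by metis
    have eeff: "e \<bullet> e = 1" "f \<bullet> f = 1" "f \<bullet> e = 0" using ef by (simp_all add: norm_eq_1 inner_commute)
    define W where "W = {y \<in> V. e \<bullet> y = 0 \<and> f \<bullet> y = 0}"
    have W: "subspace W" using V by (auto simp: W_def subspace_def inner_add_right)
    have zero: "B e y = 0" "B f y = 0" if "y \<in> W" for y
    proof -
      have y: "y \<in> V" "e \<bullet> y = 0" "f \<bullet> y = 0" using that by (auto simp: W_def)
      show "B e y = 0"
        using B max ef y
        by (intro functional_zero_orthogonal_to_maximizer[OF V, of "B e" f]) (auto simp: bilinear_def)
      have "linear (\<lambda>x. B x f)" using B by (simp add: bilinear_def)
      then have "B y f = 0"
        using max ef y by (intro functional_zero_orthogonal_to_maximizer[OF V, of "\<lambda>x. B x f" e]) auto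
      then show "B f y = 0" using skew[of f y] by simp
    qed
    have "e \<notin> W" using eeff(1) by (simp add: W_def)
    have "W \<subseteq> V" by (auto simp: W_def)
    with \<open>e \<notin> W\<close> have "W \<subset> V" using ef(1) by blast
    then have "dim W < dim V" using V W by (metis dim_psubset span_eq_iff)
    then obtain b c where b: "orthonormal_upto b (dim W)" "span (b ` {..<dim W}) = W"
      and Bb: "\<And>j k. j < dim W \<Longrightarrow> k < dim W \<Longrightarrow> B (b j) (b k) = skew_entry c j k"
      and c: "decseq c" "\<And>m. 0 \<le> c m" "\<And>m. dim W \<le> Suc (2 * m) \<Longrightarrow> c m = 0"
      using less.hyps[OF _ W] by metis
    have bW: "b j \<in> W" if "j < dim W" for j using b(2) that by (metis imageI lessThan_iff span_base)
    define b' where "b' = case_nat e (case_nat f b)"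
    define c' where "c' = case_nat (B e f) c"
    have b'_simps: "b' 0 = e" "b' (Suc 0) = f" "b' (Suc (Suc j)) = b j" for j by (simp_all add: b'_def)
    have index: "j = 0 \<or> j = Suc 0 \<or> (\<exists>i<dim W. j = Suc (Suc i))" if "j < Suc (Suc (dim W))" for j
      using that by (metis Suc_less_SucD not0_implies_Suc)
    have on: "orthonormal_upto b' (Suc (Suc (dim W)))"
    proof -
      have eb: "e \<bullet> b j = 0" "f \<bullet> b j = 0" "b j \<bullet> e = 0" "b j \<bullet> f = 0" if "j < dim W" for j
        using bW[OF that] by (simp_all add: W_def inner_commute[of "b j"])
      have "b' j \<bullet> b' k = (if j = k then 1 else 0)" if "j < Suc (Suc (dim W))" "k < Suc (Suc (dim W))" for j k
        using index[OF that(1)] index[OF that(2)]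
        by (elim disjE exE conjE) (simp_all add: b'_simps ef eeff eb orthonormal_uptoD[OF b(1)])
      then show ?thesis by (simp add: orthonormal_upto_def)
    qed
    have image: "b' ` {..<Suc (Suc (dim W))} = {e, f} \<union> b ` {..<dim W}"
      by (simp add: b'_def lessThan_Suc_eq_insert_0 image_image)
    have span: "span (b' ` {..<Suc (Suc (dim W))}) = V"
    proof
      show "span (b' ` {..<Suc (Suc (dim W))}) \<subseteq> V"
        using ef(1,2) bW \<open>W \<subseteq> V\<close> V unfolding image by (intro span_minimal) auto
      show "V \<subseteq> span (b' ` {..<Suc (Suc (dim W))})"
      proof
        fix x assume x: "x \<in> V"
        have "x - (e \<bullet> x) *\<^sub>R e - (f \<bullet> x) *\<^sub>R f \<in> W"
          using x ef V eeff by (auto simp: W_def inner_diff_right intro!: subspace_diff subspace_scale)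
        then have "x - (e \<bullet> x) *\<^sub>R e - (f \<bullet> x) *\<^sub>R f \<in> span (b ` {..<dim W})" using b(2) by simp
        then have *: "x - (e \<bullet> x) *\<^sub>R e - (f \<bullet> x) *\<^sub>R f \<in> span ({e, f} \<union> b ` {..<dim W})"
          by (rule rev_subsetD) (rule span_mono, blast)
        have "x - (e \<bullet> x) *\<^sub>R e - (f \<bullet> x) *\<^sub>R f + (f \<bullet> x) *\<^sub>R f + (e \<bullet> x) *\<^sub>R e \<in> span ({e, f} \<union> b ` {..<dim W})"
          by (intro span_add * span_scale span_base) auto
        then show "x \<in> span (b' ` {..<Suc (Suc (dim W))})" by (simp add: image)
      qed
    qed
    have dimV: "dim V = Suc (Suc (dim W))"
      using dim_span_orthonormal[OF on subset_refl] span by simp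
    have zero': "B e (b j) = 0" "B f (b j) = 0" "B (b j) e = 0" "B (b j) f = 0" if "j < dim W" for j
      using zero[OF bW[OF that]] skew[of "b j" e] skew[of "b j" f] by simp_all
    have entry_Suc: "skew_entry c' (Suc (Suc j)) (Suc (Suc k)) = skew_entry c j k" for j k
      by (simp add: skew_entry_def c'_def)
    have "B (b' j) (b' k) = skew_entry c' j k" if "j < Suc (Suc (dim W))" "k < Suc (Suc (dim W))" for j k
      using index[OF that(1)] index[OF that(2)]
      by (elim disjE exE conjE) (simp_all add: b'_simps self zero' Bb entry_Suc, simp_all add: skew_entry_def c'_def skew[of f e])
    moreover have "c m \<le> B e f" for m
    proof (cases "dim W \<le> Suc (2 * m)")
      case True
      have "B f e \<le> B e f" using max ef by blast
      then show ?thesis using c(3)[OF True] skew[of f e] by simp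
    next
      case False
      then have "c m = B (b (2 * m)) (b (Suc (2 * m)))" by (subst Bb) (auto simp: skew_entry_def)
      also have "\<dots> \<le> B e f"
        using False bW orthonormal_uptoD[OF b(1)] by (intro max) (auto simp: W_def norm_eq_1)
      finally show ?thesis .
    qed
    moreover have "0 \<le> B e f" using \<open>c 0 \<le> B e f\<close> c(2)[of 0] by simp
    ultimately have "\<forall>j<dim V. \<forall>k<dim V. B (b' j) (b' k) = skew_entry c' j k" "decseq c'" "\<forall>m. 0 \<le> c' m"
      using c(1,2) by (auto simp: dimV c'_def decseq_Suc_iff split: nat.split)
    moreover have "\<forall>m. dim V \<le> Suc (2 * m) \<longrightarrow> c' m = 0"
      using c(3) by (auto simp: dimV c'_def split: nat.split)
    ultimately show ?thesis using on span unfolding dimV by blast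
  qed
qed

section \<open>Uniqueness of principal angles\<close>

text \<open>
  The minimax principle for singular values. The span of the first \<open>k + 1\<close> vectors of \<open>a\<close> and the
  span of the vectors of \<open>a'\<close> from position \<open>k\<close> on have dimensions that add up to \<open>d + 1\<close>, so they share
  some \<open>x \<noteq> 0\<close>. The first description gives a vector \<open>y \<in> W\<close> of the same norm with
  \<open>x \<bullet> y \<ge> c k * (x \<bullet> x)\<close>, and by the second one no such vector exceeds \<open>c' k * (x \<bullet> x)\<close>.
\<close>

lemma principal_cosines_le:
  fixes a a' b b' :: "nat \<Rightarrow> 'a::euclidean_space"
  assumes a: "orthonormal_upto a d" "span (a ` {..<d}) = V" and b: "orthonormal_upto b d" "span (b ` {..<d}) = W"
    and a': "orthonormal_upto a' d" "span (a' ` {..<d}) = V" and b': "orthonormal_upto b' d" "span (b' ` {..<d}) = W"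
    and ab: "\<And>i j. i < d \<Longrightarrow> j < d \<Longrightarrow> a i \<bullet> b j = (if i = j then c i else 0)"
    and ab': "\<And>i j. i < d \<Longrightarrow> j < d \<Longrightarrow> a' i \<bullet> b' j = (if i = j then c' i else 0)"
    and c: "\<And>i j. i \<le> j \<Longrightarrow> j < d \<Longrightarrow> c j \<le> c i" and c': "\<And>i j. i \<le> j \<Longrightarrow> j < d \<Longrightarrow> c' j \<le> c' i"
    and nonneg: "\<And>i. i < d \<Longrightarrow> 0 \<le> c' i" and k: "k < d"
  shows "c k \<le> c' k"
proof -
  define X where "X = span (a ` {..k})"
  define X' where "X' = span (a' ` {k..<d})"
  have "dim {x + y | x y. x \<in> X \<and> y \<in> X'} + dim (X \<inter> X') = dim X + dim X'"
    by (rule dim_sums_Int) (simp_all add: X_def X'_def)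
  moreover have "dim X = Suc k" "dim X' = d - k"
    unfolding X_def X'_def using k by (subst dim_span_orthonormal[OF a(1)] dim_span_orthonormal[OF a'(1)]; auto)+
  moreover have "dim {x + y | x y. x \<in> X \<and> y \<in> X'} \<le> d"
  proof -
    have "X \<subseteq> V" unfolding X_def a(2)[symmetric] using k by (intro span_mono) auto
    moreover have "X' \<subseteq> V" unfolding X'_def a'(2)[symmetric] by (intro span_mono) auto
    ultimately have "{x + y | x y. x \<in> X \<and> y \<in> X'} \<subseteq> V"
      unfolding a(2)[symmetric] by (auto intro: span_add)
    then have "dim {x + y | x y. x \<in> X \<and> y \<in> X'} \<le> dim V" by (rule dim_subset)
    then show ?thesis using dim_span_orthonormal[OF a(1) subset_refl] a(2) by simp
  qed
  ultimately have "dim (X \<inter> X') \<noteq> 0" using k by linarith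
  then obtain x where x: "x \<in> X" "x \<in> X'" "x \<noteq> 0" by (auto simp: dim_eq_0)
  obtain \<alpha> where \<alpha>: "x = (\<Sum>j\<le>k. \<alpha> j *\<^sub>R a j)" using span_image_sum[of "{..k}" x a] x(1) by (auto simp: X_def)
  obtain \<beta> where \<beta>: "x = (\<Sum>j\<in>{k..<d}. \<beta> j *\<^sub>R a' j)" using span_image_sum[of "{k..<d}" x a'] x(2) by (auto simp: X'_def)
  define y where "y = (\<Sum>j\<le>k. \<alpha> j *\<^sub>R b j)"
  define z where "z = (\<Sum>j\<in>{k..<d}. (\<beta> j * c' j) *\<^sub>R b' j)"
  have sub: "{..k} \<subseteq> {..<d}" "{k..<d} \<subseteq> {..<d}" using k by auto
  have xx: "x \<bullet> x = (\<Sum>j\<le>k. \<alpha> j * \<alpha> j)" "x \<bullet> x = (\<Sum>j\<in>{k..<d}. \<beta> j * \<beta> j)"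
    using inner_orthonormal_sums[OF a(1) sub(1), of \<alpha> \<alpha>] inner_orthonormal_sums[OF a'(1) sub(2), of \<beta> \<beta>] \<alpha> \<beta> by simp_all
  have yy: "y \<bullet> y = x \<bullet> x"
    using inner_orthonormal_sums[OF b(1) sub(1), of \<alpha> \<alpha>] xx(1) by (simp add: y_def)
  have zz: "z \<bullet> z \<le> (c' k)\<^sup>2 * (x \<bullet> x)"
  proof -
    have "z \<bullet> z = (\<Sum>j\<in>{k..<d}. (c' j)\<^sup>2 * (\<beta> j * \<beta> j))"
      using inner_orthonormal_sums[OF b'(1) sub(2)] by (simp add: z_def power2_eq_square mult_ac)
    also have "\<dots> \<le> (\<Sum>j\<in>{k..<d}. (c' k)\<^sup>2 * (\<beta> j * \<beta> j))"
      by (intro sum_mono mult_right_mono power_mono c' nonneg) auto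
    finally show ?thesis by (simp add: xx(2) sum_distrib_left)
  qed
  have "x \<bullet> y = (\<Sum>i\<le>k. \<alpha> i * (a i \<bullet> y))" by (subst \<alpha>) (simp add: inner_sum_left)
  also have "\<dots> = (\<Sum>i\<le>k. \<alpha> i * (\<alpha> i * c i))"
  proof (rule sum.cong[OF refl])
    fix i assume i: "i \<in> {..k}"
    have "a i \<bullet> y = (\<Sum>j\<le>k. if i = j then \<alpha> j * c j else 0)"
      unfolding y_def inner_sum_right using i k by (intro sum.cong) (auto simp: ab)
    then show "\<alpha> i * (a i \<bullet> y) = \<alpha> i * (\<alpha> i * c i)" using i by simp
  qed
  also have "\<dots> \<ge> (\<Sum>i\<le>k. c k * (\<alpha> i * \<alpha> i))"
  proof (rule sum_mono)
    fix i assume "i \<in> {..k}"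
    then have "c k * (\<alpha> i * \<alpha> i) \<le> c i * (\<alpha> i * \<alpha> i)" using c k by (intro mult_right_mono) auto
    then show "c k * (\<alpha> i * \<alpha> i) \<le> \<alpha> i * (\<alpha> i * c i)" by (simp add: mult_ac)
  qed
  finally have lower: "c k * (x \<bullet> x) \<le> x \<bullet> y" by (simp add: xx(1) sum_distrib_left)
  have "x \<bullet> y = z \<bullet> y"
  proof -
    have "y \<in> W" unfolding y_def b(2)[symmetric] using k by (intro span_sum span_scale span_base) auto
    then have y: "y = (\<Sum>j<d. (b' j \<bullet> y) *\<^sub>R b' j)"
      using b'(2) by (intro span_orthonormal_expansion[OF b'(1)]) simp
    have "a' i \<bullet> y = c' i * (b' i \<bullet> y)" if "i < d" for i
    proof -
      have "a' i \<bullet> y = (\<Sum>j<d. (b' j \<bullet> y) * (a' i \<bullet> b' j))" by (subst y) (simp add: inner_sum_right)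
      also have "\<dots> = (\<Sum>j<d. if i = j then (b' j \<bullet> y) * c' j else 0)"
        using that by (intro sum.cong) (auto simp: ab')
      finally show ?thesis using that by simp
    qed
    then show ?thesis by (subst \<beta>) (simp add: z_def inner_sum_left mult_ac)
  qed
  also have "\<dots> \<le> norm z * norm y" by (rule norm_cauchy_schwarz)
  also have "\<dots> \<le> (c' k * norm x) * norm x"
  proof (rule mult_mono)
    have "(norm z)\<^sup>2 \<le> (c' k * norm x)\<^sup>2"
      using zz by (simp only: power2_norm_eq_inner power_mult_distrib)
    then show "norm z \<le> c' k * norm x"
      by (rule power2_le_imp_le) (use nonneg[OF k] in simp)
    show "norm y \<le> norm x" using yy by (simp add: norm_eq_sqrt_inner)
  qed (use nonneg[OF k] in simp_all)
  also have "\<dots> = c' k * (x \<bullet> x)" 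
    by (simp only: power2_norm_eq_inner[symmetric] power2_eq_square mult.assoc)
  finally have "c k * (x \<bullet> x) \<le> c' k * (x \<bullet> x)" using lower by linarith
  then show ?thesis using x(3) by (simp add: mult_le_cancel_right)
qed

lemma orthonormal_basis_iff:
  "orthonormal_basis xs V \<longleftrightarrow> orthonormal_upto ((!) xs) (length xs) \<and> span ((!) xs ` {..<length xs}) = V"
proof -
  have "set xs = (!) xs ` {..<length xs}" by (auto simp: set_conv_nth)
  then show ?thesis by (auto simp: orthonormal_basis_def orthonormal_upto_def)
qed

lemma orthonormal_basisD:
  fixes V :: "'a::euclidean_space set"
  assumes "orthonormal_basis xs V"
  shows "orthonormal_upto ((!) xs) (dim V)" "span ((!) xs ` {..<dim V}) = V"
proof -
  have "dim V = length xs"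
    using assms dim_span_orthonormal[of "(!) xs" "length xs" "{..<length xs}"] by (auto simp: orthonormal_basis_iff)
  then show "orthonormal_upto ((!) xs) (dim V)" "span ((!) xs ` {..<dim V}) = V"
    using assms by (simp_all add: orthonormal_basis_iff)
qed

lemma principal_angles_eqI:
  fixes V W :: "'a::euclidean_space set"
  assumes dim: "dim W = dim V" and len: "length \<theta> = dim V" and "sorted \<theta>" and "set \<theta> \<subseteq> {0..pi/2}"
    and "orthonormal_basis a V" "orthonormal_basis b W"
    and "\<forall>j<dim V. \<forall>k<dim V. a ! j \<bullet> b ! k = (if j = k then cos (\<theta> ! j) else 0)"
  shows "principal_angles V W = \<theta>"
  unfolding principal_angles_def
proof (rule the_equality)
  show "length \<theta> = dim V \<and> sorted \<theta> \<and> set \<theta> \<subseteq> {0..pi/2} \<and>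
    (\<exists>a b. orthonormal_basis a V \<and> orthonormal_basis b W \<and>
      (\<forall>j<dim V. \<forall>k<dim V. a ! j \<bullet> b ! k = (if j = k then cos (\<theta> ! j) else 0)))"
    using assms by blast
next
  fix \<theta>' assume "length \<theta>' = dim V \<and> sorted \<theta>' \<and> set \<theta>' \<subseteq> {0..pi/2} \<and>
    (\<exists>a b. orthonormal_basis a V \<and> orthonormal_basis b W \<and>
      (\<forall>j<dim V. \<forall>k<dim V. a ! j \<bullet> b ! k = (if j = k then cos (\<theta>' ! j) else 0)))"
  then obtain a' b' where \<theta>': "length \<theta>' = dim V" "sorted \<theta>'" "set \<theta>' \<subseteq> {0..pi/2}"
    and a'b': "orthonormal_basis a' V" "orthonormal_basis b' W"
      "\<forall>j<dim V. \<forall>k<dim V. a' ! j \<bullet> b' ! k = (if j = k then cos (\<theta>' ! j) else 0)"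
    by blast
  have range: "0 \<le> \<tau> ! k" "\<tau> ! k \<le> pi" "0 \<le> cos (\<tau> ! k)"
    if "length \<tau> = dim V" "set \<tau> \<subseteq> {0..pi/2}" "k < dim V" for \<tau> :: "real list" and k
  proof -
    have "\<tau> ! k \<in> {0..pi/2}" using that by (metis nth_mem subsetD)
    then show "0 \<le> \<tau> ! k" "\<tau> ! k \<le> pi" "0 \<le> cos (\<tau> ! k)" using pi_ge_zero by (auto intro!: cos_ge_zero)
  qed
  have decr: "cos (\<tau> ! j) \<le> cos (\<tau> ! i)"
    if "length \<tau> = dim V" "sorted \<tau>" "set \<tau> \<subseteq> {0..pi/2}" "i \<le> j" "j < dim V" for \<tau> :: "real list" and i j
    using that range[OF that(1,3)] by (intro cos_monotone_0_pi_le sorted_nth_mono) auto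
  have ab: "a ! i \<bullet> b ! j = (if i = j then cos (\<theta> ! i) else 0)"
    and ab': "a' ! i \<bullet> b' ! j = (if i = j then cos (\<theta>' ! i) else 0)" if "i < dim V" "j < dim V" for i j
    using assms(7) a'b'(3) that by blast+
  note V = orthonormal_basisD[OF assms(5)] orthonormal_basisD[OF a'b'(1)]
  note W = orthonormal_basisD[OF assms(6), unfolded dim] orthonormal_basisD[OF a'b'(2), unfolded dim]
  have "\<theta>' ! k = \<theta> ! k" if k: "k < dim V" for k
  proof -
    have "cos (\<theta>' ! k) \<le> cos (\<theta> ! k)"
      by (rule principal_cosines_le[OF V(3,4) W(3,4) V(1,2) W(1,2) ab' ab decr[OF \<theta>'] decr[OF assms(2-4)]
            range(3)[OF assms(2,4)] k])
    moreover have "cos (\<theta> ! k) \<le> cos (\<theta>' ! k)"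
      by (rule principal_cosines_le[OF V(1,2) W(1,2) V(3,4) W(3,4) ab ab' decr[OF assms(2-4)] decr[OF \<theta>']
            range(3)[OF \<theta>'(1,3)] k])
    ultimately have "cos (\<theta>' ! k) = cos (\<theta> ! k)" by (rule antisym)
    then show ?thesis
      by (rule cos_inj_pi[OF range(1,2)[OF \<theta>'(1,3) k] range(1,2)[OF assms(2,4) k]])
  qed
  then show "\<theta>' = \<theta>" using \<theta>'(1) len by (intro nth_equalityI) auto
qed

section \<open>Holomorphy index in normal form\<close>

lemma linear_ii: "linear (\<lambda>x :: complex ^ 'n. \<i> *s x)"
  by (rule linearI) (simp_all add: vec_eq_iff algebra_simps)

lemma inner_ii_ii: "(\<i> *s x) \<bullet> (\<i> *s y) = x \<bullet> (y :: complex ^ 'n)"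
  by (simp add: inner_vec_def inner_complex_def add.commute)

lemma inner_ii_skew: "(\<i> *s x) \<bullet> y = - ((\<i> *s y) \<bullet> (x :: complex ^ 'n))"
  unfolding inner_vec_def sum_negf[symmetric] by (simp add: inner_complex_def mult.commute)

lemma bilinear_ii: "bilinear (\<lambda>x y :: complex ^ 'n. (\<i> *s x) \<bullet> y)"
  unfolding bilinear_def
  by (auto intro!: linearI simp: inner_add_right linear_add[OF linear_ii] linear_scale[OF linear_ii] inner_add_left)

text \<open>
  An orthonormal basis of \<open>V\<close> that puts the Kaehler form \<open>(x, y) \<mapsto> (\<i> x) \<bullet> y\<close> into normal form. The
  vectors at positions \<open>2 m\<close> and \<open>2 m + 1\<close> span a plane with Kaehler angle \<open>arccos (c m)\<close>, and planes for
  different \<open>m\<close> are orthogonal for the Hermitian product.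
\<close>

definition kaehler_basis :: "(complex ^ 'n) set \<Rightarrow> (nat \<Rightarrow> complex ^ 'n) \<Rightarrow> (nat \<Rightarrow> real) \<Rightarrow> bool" where
  "kaehler_basis V b c \<longleftrightarrow> orthonormal_upto b (dim V) \<and> span (b ` {..<dim V}) = V \<and>
    (\<forall>j<dim V. \<forall>k<dim V. (\<i> *s b j) \<bullet> b k = skew_entry c j k) \<and>
    decseq c \<and> (\<forall>m. 0 \<le> c m) \<and> (\<forall>m. dim V \<le> Suc (2 * m) \<longrightarrow> c m = 0)"

lemma kaehler_basis_exists:
  assumes "subspace V" obtains b c where "kaehler_basis V b c"
  using skew_form_normal_basis[OF bilinear_ii inner_ii_skew assms] unfolding kaehler_basis_def by blast

lemma kaehler_basis_le_1:
  assumes "kaehler_basis V b c" shows "c m \<le> 1"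
proof (cases "dim V \<le> Suc (2 * m)")
  case False
  then have less: "2 * m < dim V" "Suc (2 * m) < dim V" by simp_all
  then have "c m = (\<i> *s b (2 * m)) \<bullet> b (Suc (2 * m))"
    using assms by (simp add: kaehler_basis_def skew_entry_def)
  also have "\<dots> \<le> norm (\<i> *s b (2 * m)) * norm (b (Suc (2 * m)))" by (rule norm_cauchy_schwarz)
  also have "\<dots> = 1"
    using assms less by (simp add: kaehler_basis_def orthonormal_upto_def norm_eq_sqrt_inner inner_ii_ii)
  finally show ?thesis .
qed (use assms in \<open>simp add: kaehler_basis_def\<close>)

text \<open>
  The partner of a vector of the basis is, up to sign, \<open>\<i>\<close> times the other vector of its plane. The
  two vectors of a plane therefore give the same angle twice. The unpaired last vector of an odd-dimensional
  space is the partner of itself, with angle \<open>arccos 0 = pi/2\<close>.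
\<close>

lemma principal_angles_kaehler_basis:
  assumes "kaehler_basis V b c"
  shows "principal_angles V ((\<lambda>x. \<i> *s x) ` V) = map (\<lambda>k. arccos (c (k div 2))) [0..<dim V]"
proof -
  let ?J = "\<lambda>x :: complex ^ 'a. \<i> *s x"
  define d where "d = dim V"
  have on: "orthonormal_upto b d" and span: "span (b ` {..<d}) = V"
    and form: "\<And>j k. j < d \<Longrightarrow> k < d \<Longrightarrow> ?J (b j) \<bullet> b k = skew_entry c j k"
    and c: "decseq c" "\<And>m. 0 \<le> c m" "\<And>m. d \<le> Suc (2 * m) \<Longrightarrow> c m = 0"
    using assms by (auto simp: kaehler_basis_def d_def)
  note c1 = kaehler_basis_le_1[OF assms]
  have c_ge: "- 1 \<le> c m" for m using c(2)[of m] by linarith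
  \<comment> \<open>\<open>\<sigma>\<close> exchanges the positions \<open>2 m\<close> and \<open>2 m + 1\<close>, and fixes an unpaired last position.\<close>
  define \<sigma> where "\<sigma> k = (if odd k then k - 1 else if Suc k < d then Suc k else k)" for k
  define s where "s k = (if even k \<and> Suc k < d then - 1 else 1 :: real)" for k
  define b' where "b' k = s k *\<^sub>R ?J (b (\<sigma> k))" for k
  have \<sigma>: "\<sigma> k < d" if "k < d" for k using that by (auto simp: \<sigma>_def)
  have \<sigma>_inj: "\<sigma> j = \<sigma> k \<longleftrightarrow> j = k" if "j < d" "k < d" for j k
  proof -
    have "\<sigma> (\<sigma> k) = k" if "k < d" for k
      using that by (cases "even k") (auto simp: \<sigma>_def elim!: oddE)
    then show ?thesis using that by metis
  qed
  have on': "orthonormal_upto b' d"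
    unfolding orthonormal_upto_def b'_def
    using on \<sigma> by (auto simp: inner_ii_ii orthonormal_uptoD \<sigma>_inj s_def)
  have span': "span (b' ` {..<d}) = ?J ` V"
  proof (rule subspace_dim_equal)
    have V: "subspace V" using span by auto
    then show sub: "subspace (?J ` V)" by (rule linear_subspace_image[OF linear_ii])
    have "b k \<in> V" if "k < d" for k using that span by (metis imageI lessThan_iff span_base)
    then show "span (b' ` {..<d}) \<subseteq> ?J ` V"
      using sub \<sigma> by (intro span_minimal) (auto simp: b'_def intro!: subspace_scale)
    have "dim (?J ` V) \<le> dim V" by (rule dim_image_le[OF linear_ii])
    then show "dim (?J ` V) \<le> dim (span (b' ` {..<d}))"
      using dim_span_orthonormal[OF on' subset_refl] by (simp add: d_def)
  qed simp
  then have dim': "dim (?J ` V) = d"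
    using dim_span_orthonormal[OF on' subset_refl] by simp
  have cross: "b j \<bullet> b' k = (if j = k then c (j div 2) else 0)" if "j < d" "k < d" for j k
  proof -
    have "b j \<bullet> b' k = s k * skew_entry c (\<sigma> k) j"
      using form[OF \<sigma>[OF that(2)] that(1)] by (simp add: b'_def inner_commute)
    also have "\<dots> = (if j = k then c (j div 2) else 0)"
    proof (cases "even k")
      case True
      then obtain m where k: "k = 2 * m" by (elim evenE)
      show ?thesis
      proof (cases "Suc k < d")
        case True
        then show ?thesis by (auto simp: k \<sigma>_def s_def skew_entry_def)
      next
        case False
        then have "c m = 0" using c(3)[of m] k by simp
        moreover have "\<not> (even j \<and> k = Suc j)" using k by presburger
        ultimately show ?thesis using that False by (auto simp: k \<sigma>_def s_def skew_entry_def)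
      qed
    next
      case False
      then obtain m where k: "k = Suc (2 * m)" by (elim oddE) simp
      have "\<not> (even j \<and> 2 * m = Suc j)" by presburger
      then show ?thesis by (auto simp: k \<sigma>_def s_def skew_entry_def)
    qed
    finally show ?thesis .
  qed
  show ?thesis
    unfolding d_def[symmetric]
  proof (rule principal_angles_eqI[where a = "map b [0..<d]" and b = "map b' [0..<d]"])
    show "orthonormal_basis (map b [0..<d]) V" "orthonormal_basis (map b' [0..<d]) (?J ` V)"
      using on on' span span' by (simp_all add: orthonormal_basis_iff orthonormal_upto_def)
    show "sorted (map (\<lambda>k. arccos (c (k div 2))) [0..<d])"
      by (auto simp: sorted_iff_nth_mono c1 c_ge intro!: arccos_le_arccos decseqD[OF c(1)] div_le_mono)
    show "set (map (\<lambda>k. arccos (c (k div 2))) [0..<d]) \<subseteq> {0..pi/2}"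
      using arccos_lbound[OF c_ge c1] arccos_le_pi2[OF c(2) c1] by auto
  qed (use cross in \<open>auto simp: dim' d_def[symmetric] cos_arccos c1 c_ge\<close>)
qed

lemma holomorphy_index_kaehler_basis:
  assumes "kaehler_basis V b c"
  shows "holomorphy_index V = (\<Prod>m<(dim V + 1) div 2. sqrt (1 - (c m)\<^sup>2))"
proof -
  have "- 1 \<le> c m" for m using assms by (metis kaehler_basis_def neg_le_0_iff_le order_trans zero_le_one)
  then have sin: "sin (arccos (c m)) = sqrt (1 - (c m)\<^sup>2)" for m
    using kaehler_basis_le_1[OF assms] by (simp add: sin_arccos)
  have "nat \<lceil>real (dim V) / 2\<rceil> = (dim V + 1) div 2" by linarith
  then have "holomorphy_index V = (\<Prod>j = 1..(dim V + 1) div 2. sin (kaehler_angle V j))"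
    by (simp add: holomorphy_index_def)
  also have "\<dots> = (\<Prod>m<(dim V + 1) div 2. sin (kaehler_angle V (Suc m)))"
    by (rule prod.reindex_bij_witness[of _ Suc "\<lambda>j. j - 1"]) auto
  also have "\<dots> = (\<Prod>m<(dim V + 1) div 2. sqrt (1 - (c m)\<^sup>2))"
  proof (rule prod.cong[OF refl])
    fix m assume "m \<in> {..<(dim V + 1) div 2}"
    then have "2 * m < dim V" by auto
    then have "kaehler_angle V (Suc m) = arccos (c m)"
      by (simp add: kaehler_angle_def principal_angles_kaehler_basis[OF assms])
    then show "sin (kaehler_angle V (Suc m)) = sqrt (1 - (c m)\<^sup>2)" by (simp add: sin)
  qed
  finally show ?thesis .
qed

lemma norm_smult: "norm (c *s x) = cmod c * norm (x :: complex ^ 'n)"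
  by (simp add: norm_vec_def L2_set_def norm_mult power_mult_distrib real_sqrt_mult flip: sum_distrib_left)

text \<open>
  The factor is the norm of \<open>e \<and> f\<close>. For vectors that are orthogonal over the reals, the Hermitian
  product is \<open>\<plusminus> \<i> cos \<mu>\<close> with the Kaehler angle \<open>\<mu>\<close> of their plane, so the factor is \<open>sin \<mu>\<close>.
\<close>

lemma norm_ext_pair:
  assumes "contract e a = 0" "contract f a = 0" "norm e = 1" "norm f = 1"
  shows "norm (ext (ext a e) f) = norm a * sqrt (1 - (cmod (herm e f))\<^sup>2)"
proof -
  have "(norm (ext (ext a e) f))\<^sup>2 = (norm a)\<^sup>2 * (1 - (cmod (herm e f))\<^sup>2)"
    by (simp add: norm_ext contract_ext assms norm_smult power_mult_distrib algebra_simps)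
  then have "norm (ext (ext a e) f) = sqrt ((norm a)\<^sup>2 * (1 - (cmod (herm e f))\<^sup>2))"
    by (metis norm_ge_zero real_sqrt_unique)
  then show ?thesis by (simp add: real_sqrt_mult)
qed

lemma norm_wedge_prod_kaehler_basis:
  assumes "kaehler_basis V b c"
  shows "norm (wedge_prod b (dim V)) = (\<Prod>m<(dim V + 1) div 2. sqrt (1 - (c m)\<^sup>2))"
proof -
  have on: "orthonormal_upto b (dim V)"
    and form: "\<And>j k. j < dim V \<Longrightarrow> k < dim V \<Longrightarrow> (\<i> *s b j) \<bullet> b k = skew_entry c j k"
    and c: "\<And>m. 0 \<le> c m" "\<And>m. dim V \<le> Suc (2 * m) \<Longrightarrow> c m = 0"
    using assms by (auto simp: kaehler_basis_def)
  have norm1: "norm (b k) = 1" if "k < dim V" for k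
    using orthonormal_uptoD[OF on that that] by (simp add: norm_eq_1)
  have herm: "herm (b j) (b k) = Complex 0 (- skew_entry c j k)" if "j < dim V" "k < dim V" "j \<noteq> k" for j k
    using that orthonormal_uptoD[OF on that(1,2)] by (simp add: herm_eq form)
  have contract: "contract (b k) (wedge_prod b (2 * m)) = 0" if "2 * m \<le> k" "k < dim V" "k \<le> Suc (2 * m)" for k m
  proof (rule contract_wedge_prod)
    fix j assume "j < 2 * m"
    then have "skew_entry c j k = 0" using that by (auto simp: skew_entry_def)
    then show "herm (b j) (b k) = 0" using that \<open>j < 2 * m\<close> by (simp add: herm complex_eq_iff)
  qed
  have even: "norm (wedge_prod b (2 * m)) = (\<Prod>i<m. sqrt (1 - (c i)\<^sup>2))" if "2 * m \<le> dim V" for m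
    using that
  proof (induction m)
    case (Suc m)
    have "cmod (herm (b (2 * m)) (b (Suc (2 * m)))) = c m"
      using Suc.prems c(1)[of m] by (subst herm) (auto simp: skew_entry_def cmod_def)
    then have "norm (wedge_prod b (2 * Suc m)) = norm (wedge_prod b (2 * m)) * sqrt (1 - (c m)\<^sup>2)"
      using Suc.prems by (simp add: norm_ext_pair contract norm1)
    then show ?case using Suc by simp
  qed (simp add: norm_eq_sqrt_inner inner_axis_axis)
  obtain m where m: "dim V = 2 * m \<or> dim V = Suc (2 * m)" by (metis evenE oddE Suc_eq_plus1)
  then show ?thesis
  proof
    assume "dim V = 2 * m" then show ?thesis using even[of m] by simp
  next
    assume d: "dim V = Suc (2 * m)"
    then have "norm (wedge_prod b (dim V)) = norm (wedge_prod b (2 * m))"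
      by (simp add: norm_ext_orthogonal contract norm1)
    then show ?thesis using d even[of m] c(2)[of m] by simp
  qed
qed

section \<open>Norm of a product of vectors\<close>

lemma orth_component:
  fixes v :: "nat \<Rightarrow> 'a::euclidean_space"
  shows "\<exists>c. orth_component v k = v k - (\<Sum>j<k. c j *\<^sub>R v j)" "j < k \<Longrightarrow> v j \<bullet> orth_component v k = 0"
  using theI'[OF orth_component_unique[of v k]] unfolding orth_component_def[symmetric] by auto

lemma inner_orth_components:
  fixes v :: "nat \<Rightarrow> 'a::euclidean_space"
  assumes "j \<noteq> k" shows "orth_component v j \<bullet> orth_component v k = 0"
proof -
  have *: "orth_component v j \<bullet> orth_component v k = 0" if "j < k" for j k
  proof -
    obtain c where "orth_component v j = v j - (\<Sum>i<j. c i *\<^sub>R v i)" using orth_component(1) by blast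
    then show ?thesis using orth_component(2)[of _ k v] that by (simp add: inner_diff_left inner_sum_left)
  qed
  show ?thesis
  proof (cases "j < k")
    case False
    then show ?thesis using *[of k j] assms by (simp add: inner_commute)
  qed (rule *)
qed

lemma parallelotope_volume_eq_prod: "parallelotope_volume v p = (\<Prod>k<p. norm (orth_component v k))"
  by (induction p) simp_all

text \<open>
  Real Gram-Schmidt and normalization extract the volume. If the volume is not \<open>0\<close>, a real orthonormal
  basis of the span remains, and it can be exchanged for the one in normal form.
\<close>

lemma norm_wedge_prod_eq:
  fixes v :: "nat \<Rightarrow> complex ^ 'n"
  shows "norm (wedge_prod v p) = holomorphy_index (span (v ` {..<p})) * parallelotope_volume v p"
proof -
  define V where "V = span (v ` {..<p})"
  define u where "u = orth_component v"
  define w where "w k = (1 / norm (u k)) *\<^sub>R u k" for k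
  have "wedge_prod v p = wedge_prod u p"
  proof (rule wedge_prod_unitriangular[symmetric])
    fix k
    obtain c where "u k = v k - (\<Sum>j<k. c j *\<^sub>R v j)" using orth_component(1)[of v k] unfolding u_def by blast
    then show "\<exists>c. u k = v k - (\<Sum>j<k. c j *s v j)" by (auto simp: scaleR_eq_smult)
  qed
  also have "u = (\<lambda>k. norm (u k) *\<^sub>R w k)" by (auto simp: w_def)
  then have "wedge_prod u p = (\<Prod>k<p. norm (u k)) *\<^sub>R wedge_prod w p" using wedge_prod_scaleR by metis
  finally have vw: "norm (wedge_prod v p) = parallelotope_volume v p * norm (wedge_prod w p)"
    by (simp add: parallelotope_volume_eq_prod u_def prod_nonneg)
  show ?thesis
  proof (cases "parallelotope_volume v p = 0")
    case False
    then have u0: "u k \<noteq> 0" if "k < p" for k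
      using that by (auto simp: parallelotope_volume_eq_prod u_def)
    have w: "orthonormal_upto w p"
      using u0 by (auto simp: orthonormal_upto_def w_def inner_orth_components u_def simp flip: power2_norm_eq_inner)
        (auto simp: power2_eq_square)
    have wV: "w k \<in> V" if "k < p" for k
    proof -
      obtain c where "u k = v k - (\<Sum>j<k. c j *\<^sub>R v j)" using orth_component(1)[of v k] unfolding u_def by blast
      moreover have "v k - (\<Sum>j<k. c j *\<^sub>R v j) \<in> V"
        unfolding V_def using that by (intro span_diff span_sum span_scale span_base) auto
      ultimately show ?thesis by (simp add: w_def V_def span_scale)
    qed
    have "p = dim (span (w ` {..<p}))" using dim_span_orthonormal[OF w subset_refl] by simp
    also have "\<dots> \<le> dim V"
      by (intro dim_subset span_minimal) (use wV in \<open>auto simp: V_def\<close>)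
    finally have "p \<le> dim V" .
    moreover have "dim V \<le> p"
      using dim_le_card'[of "v ` {..<p}"] card_image_le[of "{..<p}" v] by (simp add: V_def)
    ultimately have p: "dim V = p" by simp
    obtain b c where b: "kaehler_basis V b c" using kaehler_basis_exists[of V] by (auto simp: V_def)
    then have "orthonormal_upto b p" "span (b ` {..<p}) = V" by (simp_all add: kaehler_basis_def p)
    then obtain \<epsilon> where "\<bar>\<epsilon>\<bar> = 1" "wedge_prod w p = \<epsilon> *\<^sub>R wedge_prod b p"
      using wedge_prod_orthonormal_eq[OF w, of b] wV by blast
    then have "norm (wedge_prod w p) = holomorphy_index V"
      using norm_wedge_prod_kaehler_basis[OF b] holomorphy_index_kaehler_basis[OF b] p by simp
    then show ?thesis using vw by (simp add: V_def)
  qed (simp add: vw)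
qed

theorem theorem6p1:
  fixes v :: "nat \<Rightarrow> complex ^ 'n" and p :: nat and V :: "(complex ^ 'n) set"
  assumes V: "V = span (v ` {..<p})"
  shows "norm (wedge_prod v p) = holomorphy_index V * parallelotope_volume v p \<and>
    (p = CARD('n) \<longrightarrow>
      (\<forall>pos :: 'n \<Rightarrow> nat. bij_betw pos UNIV {..<p} \<longrightarrow>
        cmod (det (\<chi> i j. v (pos j) $ i)) = holomorphy_index V * parallelotope_volume v p))"
  using norm_wedge_prod_eq[of v p] norm_det_eq_norm_wedge_prod[of _ p v] V by simp

end
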